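(* The algorithm $\mathcal{P}$ described in the context is an adversarially robust $O(\Delta^3)$-coloring algorithm for insert-only graph streams on $[n]$ whose maximum degree always stays at most $L$ (where $\Delta$ is the current maximum degree): it stores $O(n(\log n)^4)$ bits related to the graph, requires access to $\widetilde{O}(nL)$ random bits, and even against an adaptive adversary succeeds (i.e. never aborts and always returns a proper coloring with $O(\Delta^3)$ colors) with probability at least $1 - O(1/n^2)$.
   Context: $\log$ is base 2; $\widetilde{O}$ hides polylogarithmic factors in $n$. Algorithm $\mathcal{P}$ (parameters $n$ and a known degree bound $L$). Random bits: for each vertex $x \in [n]$ and each $i \in [L]$, independently, $P^i_x$ is a list of $4\log n$ colors sampled uniformly at random with replacement from $[2i^2]$. Initialization: for each vertex $x$, $\mathrm{deg}(x) = 0$ and $\mathrm{clr}(x) = (0,0)$; $A$ is an empty set of edges. Processing an edge $\{u,v\}$: increase $\mathrm{deg}(u)$ and $\mathrm{deg}(v)$ by one; let $k = \max\{\mathrm{deg}(u),\mathrm{deg}(v)\}$; if for some $i \in \{k,\dots,L\}$ the lists $P^i_u$ and $P^i_v$ share a color, add $\{u,v\}$ to $A$. Then let $\mathrm{used} = \{\mathrm{clr}(w) : \{u,w\} \in A\}$; for $j = 1,\dots,4\log n$, let $c = (\mathrm{deg}(u), P^{\mathrm{deg}(u)}_u[j])$ and if $c \notin \mathrm{used}$, set $\mathrm{clr}(u) = c$ and stop processing this edge; if no $j$ succeeds, abort. Query: return the vector $\mathrm{clr}$. Adaptive adversary model: the adversary generates the stream edge by edge (no repeats, degrees at most $L$),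 each edge being an arbitrary deterministic function of the colorings returned by queries after all previous edges.
   Formalization: The recolored endpoint u is taken to be one of larger degree (ties arbitrary), since the claim fails for arbitrary u; the space bound holds as part of the high-probability event rather than in the worst case; the random-bit bound is stated for L ≤ n. *)

theory Defs
  imports "HOL-Probability.Probability"
begin

section \<open>Graph streams on the vertex set \<open>{1..n}\<close>\<close>

definition edges_of :: "(nat \<times> nat) list \<Rightarrow> nat set set" where
  "edges_of es = (\<lambda>(a, b). {a, b}) ` set es"

definition degree_in :: "nat set set \<Rightarrow> nat \<Rightarrow> nat" where
  "degree_in E x = card {e \<in> E. x \<in> e}"

definition max_degree :: "nat \<Rightarrow> nat set set \<Rightarrow> nat" where
  "max_degree n E = Max (degree_in E ` {1..n})"

definition legal_stream :: "nat \<Rightarrow> nat \<Rightarrow> (nat \<times> nat) list \<Rightarrow> bool" where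
  "legal_stream n L es \<longleftrightarrow>
     (\<forall>(a, b) \<in> set es. a \<in> {1..n} \<and> b \<in> {1..n} \<and> a \<noteq> b) \<and>
     distinct (map (\<lambda>(a, b). {a, b}) es) \<and>
     (\<forall>x \<in> {1..n}. degree_in (edges_of es) x \<le> L)"

definition proper_coloring :: "nat set set \<Rightarrow> (nat \<Rightarrow> 'c) \<Rightarrow> bool" where
  "proper_coloring E c \<longleftrightarrow> (\<forall>a b. {a, b} \<in> E \<longrightarrow> c a \<noteq> c b)"


section \<open>The algorithm\<close>

type_synonym color = "nat \<times> nat"

text \<open>\<open>P (x, i)\<close> is the list of colors of vertex \<open>x\<close> at level \<open>i\<close>.\<close>
type_synonym color_lists = "nat \<times> nat \<Rightarrow> nat list"

definition list_len :: "nat \<Rightarrow> nat" where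
  "list_len n = nat \<lceil>4 * log 2 (real n)\<rceil>"

definition lists_pmf :: "nat \<Rightarrow> nat \<Rightarrow> color_lists pmf" where
  "lists_pmf n L = Pi_pmf ({1..n} \<times> {1..L}) []
     (\<lambda>(x, i). replicate_pmf (list_len n) (pmf_of_set {1..2 * i\<^sup>2}))"

record alg_state =
  degs :: "nat \<Rightarrow> nat"
  clr :: "nat \<Rightarrow> color"
  stored :: "nat set set"  \<comment> \<open>the edge set \<open>A\<close>\<close>

definition init_state :: alg_state where
  "init_state = \<lparr>degs = (\<lambda>_. 0), clr = (\<lambda>_. (0, 0)), stored = {}\<rparr>"

text \<open>
  Only the endpoint named \<open>u\<close> is recolored, so it matters which endpoint of the unordered edge
  gets that name: it is one of maximal degree, a tie being resolved by the order in which the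
  edge is presented. (If \<open>u\<close> could be the endpoint of smaller degree, the coloring would not
  stay proper: once \<open>v\<close> has a color \<open>(1, c)\<close> and a large degree \<open>k\<close>, an edge to a fresh vertex
  \<open>u\<close> is typically not stored, as only levels \<open>i \<ge> k\<close> are compared, and \<open>u\<close> then receives the
  color \<open>(1, c)\<close> with probability about one half.)

  The result \<open>None\<close> means that the algorithm aborts.
\<close>
definition process_edge ::
    "nat \<Rightarrow> color_lists \<Rightarrow> nat \<times> nat \<Rightarrow> alg_state \<Rightarrow> alg_state option" where
  "process_edge L P = (\<lambda>(a, b) s.
     let d = (degs s)(a := degs s a + 1, b := degs s b + 1);
         (u, v) = (if d b \<le> d a then (a, b) else (b, a));
         k = max (d u) (d v);
         A = (if \<exists>i \<in> {k..L}. set (P (u, i)) \<inter> set (P (v, i)) \<noteq> {}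
              then insert {u, v} (stored s) else stored s);
         used = {clr s w | w. {u, w} \<in> A}
     in case find (\<lambda>c. (d u, c) \<notin> used) (P (u, d u)) of
          None \<Rightarrow> None
        | Some c \<Rightarrow> Some \<lparr>degs = d, clr = (clr s)(u := (d u, c)), stored = A\<rparr>)"


section \<open>Adaptive adversaries\<close>

text \<open>
  An adversary maps the list of the colorings returned after each of the previous edges to the
  next edge, or to \<open>None\<close> if it ends the stream.
\<close>
type_synonym adversary = "(nat \<Rightarrow> color) list \<Rightarrow> (nat \<times> nat) option"

text \<open>
  Legality is required for every sequence of answers. This is no restriction: an adversary may
  end the stream on answers that cannot occur.
\<close>
definition legal_adversary :: "nat \<Rightarrow> nat \<Rightarrow> adversary \<Rightarrow> bool" where
  "legal_adversary n L adv \<longleftrightarrow>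
     (\<forall>cs es. map (\<lambda>t. adv (take t cs)) [0..<Suc (length cs)] = map Some es \<longrightarrow>
        legal_stream n L es)"

text \<open>
  The first \<open>t\<close> rounds of the game: the state, the edges inserted so far and the colorings
  returned so far. The result is \<open>None\<close> if the algorithm has aborted; once the adversary has
  ended the stream, nothing changes any more.
\<close>
primrec run ::
    "nat \<Rightarrow> color_lists \<Rightarrow> adversary \<Rightarrow> nat \<Rightarrow>
      (alg_state \<times> (nat \<times> nat) list \<times> (nat \<Rightarrow> color) list) option" where
  "run L P adv 0 = Some (init_state, [], [])"
| "run L P adv (Suc t) =
     (case run L P adv t of
        None \<Rightarrow> None
      | Some (s, es, cs) \<Rightarrow>
          (case adv cs of
             None \<Rightarrow> Some (s, es, cs)
           | Some e \<Rightarrow>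
               (case process_edge L P e s of
                  None \<Rightarrow> None
                | Some s' \<Rightarrow> Some (s', es @ [e], cs @ [clr s']))))"


section \<open>Bit counts\<close>

text \<open>Length of the (self-delimiting) Elias gamma code of \<open>m + 1\<close>.\<close>
definition code_len :: "nat \<Rightarrow> nat" where
  "code_len m = 2 * nat \<lfloor>log 2 (real m + 1)\<rfloor> + 1"

text \<open>
  Everything the algorithm keeps apart from its random bits: degrees, colors, and the stored
  edges preceded by their number.
\<close>
definition state_bits :: "nat \<Rightarrow> alg_state \<Rightarrow> nat" where
  "state_bits n s =
     (\<Sum>x = 1..n. code_len (degs s x) + code_len (fst (clr s x)) + code_len (snd (clr s x))) +
     code_len (card (stored s)) + (\<Sum>e \<in> stored s. \<Sum>x \<in> e. code_len x)"

text \<open>A color from \<open>{1..2 * i\<^sup>2}\<close> takes \<open>\<lceil>log 2 (2 * i\<^sup>2)\<rceil>\<close> random bits.\<close>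
definition random_bits :: "nat \<Rightarrow> nat \<Rightarrow> color_lists \<Rightarrow> nat" where
  "random_bits n L P =
     (\<Sum>x = 1..n. \<Sum>i = 1..L. length (P (x, i)) * nat \<lceil>log 2 (2 * (real i)\<^sup>2)\<rceil>)"

end

theory Submission
  imports Defs
begin

text \<open>
  If an edge \<open>{u, w}\<close> was not stored, then the lists of \<open>u\<close> and \<open>w\<close> are disjoint at all levels from
  the level at which the edge arrived, and one endpoint has had a color of at least that level ever
  since. So a color of \<open>w\<close> at the level at which \<open>u\<close> is recolored is no conflict unless the
  edge is stored. Hence the coloring stays proper unless the algorithm aborts, and the colorings
  do not depend on the stored set at all: before \<open>u\<close> reaches degree \<open>k\<close>, the adversary has learnt
  nothing about the list of \<open>u\<close> at level \<open>k\<close>.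

  When that list is first used, at most \<open>k\<close> of the \<open>2k\<^sup>2\<close> colors are blocked, so an abort has
  probability at most \<open>2\<^bsup>-4 log n\<^esup>\<close>; a union bound over \<open>u\<close> and \<open>k\<close> gives \<open>n\<^sup>-\<^sup>2\<close>.
  For the space, fix \<open>u\<close>. When its \<open>j\<close>-th edge \<open>{u, v}\<close> arrives at level \<open>k \<ge> j\<close>, the lists of
  \<open>v\<close> at the levels \<open>i \<ge> k\<close> are fresh, so the edge is stored with conditional probability
  \<open>O(log\<^sup>2 n \<Sum>\<^sub>i\<^sub>\<ge>\<^sub>k i\<^sup>-\<^sup>2) = O(log\<^sup>2 n / j)\<close>. These sum to \<open>O(log\<^sup>3 n)\<close>, and an exponential
  supermartingale shows that \<open>u\<close> has \<open>O(log\<^sup>3 n)\<close> stored edges with high probability.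
\<close>

section \<open>Product distributions and elementary sums\<close>

text \<open>The product distribution factors into its parts over \<open>B\<close> and
  \<open>I - B\<close>, so overwriting the coordinates in \<open>B\<close> by fresh samples does not
  change it. This plays the role of conditioning on all coordinates outside
  \<open>B\<close>.\<close>

lemma nn_integral_Pi_pmf_resample:
  assumes "finite I" "B \<subseteq> I"
  shows "(\<integral>\<^sup>+P. h P \<partial>Pi_pmf I d p) =
    (\<integral>\<^sup>+P. (\<integral>\<^sup>+Q. h (\<lambda>x. if x \<in> B then Q x else P x) \<partial>Pi_pmf B d p) \<partial>Pi_pmf I d p)"
proof -
  have fin: "finite B" "finite (I - B)" using assms finite_subset by auto
  have I: "I = B \<union> (I - B)" using assms by auto
  have eq: "Pi_pmf I d p = map_pmf (\<lambda>(f, g) x. if x \<in> B then f x else g x)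
      (pair_pmf (Pi_pmf B d p) (Pi_pmf (I - B) d p))"
    by (subst I, rule Pi_pmf_union) (use fin in auto)
  have ov: "(\<lambda>x. if x \<in> B then Q x else if x \<in> B then f x else g x) =
      (\<lambda>x. if x \<in> B then Q x else g x)" for Q f g :: "'a \<Rightarrow> 'b"
    by auto
  have "(\<integral>\<^sup>+P. (\<integral>\<^sup>+Q. h (\<lambda>x. if x \<in> B then Q x else P x) \<partial>Pi_pmf B d p) \<partial>Pi_pmf I d p)
     = (\<integral>\<^sup>+g. (\<integral>\<^sup>+Q. h (\<lambda>x. if x \<in> B then Q x else g x) \<partial>Pi_pmf B d p) \<partial>Pi_pmf (I - B) d p)"
    unfolding eq by (simp add: nn_integral_pair_pmf' case_prod_unfold ov cong: if_cong)
  also have "\<dots> = (\<integral>\<^sup>+x. h (\<lambda>y. if y \<in> B then snd x y else fst x y)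
      \<partial>pair_pmf (Pi_pmf (I - B) d p) (Pi_pmf B d p))"
    by (subst nn_integral_pair_pmf') (simp cong: if_cong)
  also have "\<dots> = (\<integral>\<^sup>+P. h P \<partial>Pi_pmf I d p)"
    unfolding eq by (subst pair_commute_pmf) (simp add: case_prod_unfold cong: if_cong)
  finally show ?thesis by simp
qed

lemma nn_integral_Pi_pmf_resample_le:
  assumes "finite I" "B \<subseteq> I"
    and "\<And>P. P \<in> set_pmf (Pi_pmf I d p) \<Longrightarrow>
      (\<integral>\<^sup>+Q. h (\<lambda>x. if x \<in> B then Q x else P x) \<partial>Pi_pmf B d p) \<le> g P"
  shows "(\<integral>\<^sup>+P. h P \<partial>Pi_pmf I d p) \<le> (\<integral>\<^sup>+P. g P \<partial>Pi_pmf I d p)"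
  by (subst nn_integral_Pi_pmf_resample[OF assms(1,2)], rule nn_integral_mono_AE)
     (use assms(3) in \<open>auto simp: AE_measure_pmf_iff\<close>)

text \<open>A bound valid for every choice of the other coordinates carries over to the whole
  product: resample only \<open>i\<close> and integrate.\<close>

lemma emeasure_Pi_pmf_resample_le:
  assumes "finite I" "i \<in> I"
    and le: "\<And>P. P \<in> set_pmf (Pi_pmf I d p) \<Longrightarrow>
      emeasure (measure_pmf (p i)) {x. P(i := x) \<in> X} \<le> c"
  shows "emeasure (measure_pmf (Pi_pmf I d p)) X \<le> c"
proof -
  have "emeasure (measure_pmf (Pi_pmf I d p)) X = (\<integral>\<^sup>+P. indicator X P \<partial>Pi_pmf I d p)"
    by simp
  also have "\<dots> \<le> (\<integral>\<^sup>+P. c \<partial>Pi_pmf I d p)"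
  proof (rule nn_integral_Pi_pmf_resample_le[where B = "{i}"])
    fix P assume P: "P \<in> set_pmf (Pi_pmf I d p)"
    have upd: "(\<lambda>x. if x \<in> {i} then Q x else P x) = P(i := Q i)" for Q by auto
    have "(\<integral>\<^sup>+Q. indicator X (\<lambda>x. if x \<in> {i} then Q x else P x) \<partial>Pi_pmf {i} d p)
      = (\<integral>\<^sup>+x. indicator X (P(i := x)) \<partial>map_pmf (\<lambda>f. f i) (Pi_pmf {i} d p))"
      unfolding upd by simp
    also have "\<dots> = (\<integral>\<^sup>+x. indicator {x. P(i := x) \<in> X} x \<partial>p i)"
      by (subst Pi_pmf_component) (auto simp: indicator_def simp del: nn_integral_indicator intro!: nn_integral_cong)
    also have "\<dots> = emeasure (measure_pmf (p i)) {x. P(i := x) \<in> X}" by simp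
    finally show "(\<integral>\<^sup>+Q. indicator X (\<lambda>x. if x \<in> {i} then Q x else P x) \<partial>Pi_pmf {i} d p) \<le> c"
      using le[OF P] by simp
  qed (use assms in auto)
  finally show ?thesis by simp
qed

section \<open>Hitting probabilities for lists of independent samples\<close>

lemma measure_replicate_pmf_subset:
  "measure_pmf.prob (replicate_pmf m p) {xs. set xs \<subseteq> S} = measure_pmf.prob p S ^ m"
proof (induction m)
  case (Suc m)
  have "emeasure (replicate_pmf (Suc m) p) {xs. set xs \<subseteq> S} =
      (\<integral>\<^sup>+x. (\<integral>\<^sup>+xs. indicator S x * indicator {xs. set xs \<subseteq> S} xs \<partial>replicate_pmf m p) \<partial>p)"
    by (auto intro!: nn_integral_cong simp: indicator_def)
  also have "\<dots> = emeasure p S * emeasure (replicate_pmf m p) {xs. set xs \<subseteq> S}"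
    by (simp add: nn_integral_cmult nn_integral_multc)
  finally show ?case
    by (simp add: measure_pmf.emeasure_eq_measure Suc flip: ennreal_mult del: replicate_pmf.simps)
qed simp

lemma measure_replicate_pmf_meets:
  "measure_pmf.prob (replicate_pmf m p) {xs. set xs \<inter> S \<noteq> {}} \<le> m * measure_pmf.prob p S"
proof -
  let ?a = "measure_pmf.prob p S"
  have a: "0 \<le> ?a" "?a \<le> 1" by auto
  have "{xs. set xs \<inter> S \<noteq> {}} = UNIV - {xs. set xs \<subseteq> - S}" by auto
  then have "measure_pmf.prob (replicate_pmf m p) {xs. set xs \<inter> S \<noteq> {}}
      = 1 - measure_pmf.prob p (- S) ^ m"
    using measure_pmf.prob_compl[of "{xs. set xs \<subseteq> - S}" "replicate_pmf m p"]
    by (simp add: measure_replicate_pmf_subset)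
  also have "measure_pmf.prob p (- S) = 1 - ?a"
    using measure_pmf.prob_compl[of S p] by (simp add: Compl_eq_Diff_UNIV)
  \<comment> \<open>Bernoulli's inequality takes the place of a union bound over the
    \<open>m\<close> draws.\<close>
  also have "1 - (1 - ?a) ^ m \<le> m * ?a"
    using Bernoulli_inequality[of "- ?a" m] a by simp
  finally show ?thesis .
qed

lemma measure_pmf_of_set_le:
  assumes "finite A" "A \<noteq> {}" "finite S"
  shows "measure_pmf.prob (pmf_of_set A) S \<le> card S / card A"
  using assms by (auto simp: measure_pmf_of_set intro!: divide_right_mono card_mono)

text \<open>Telescoping: for i > 1, \<open>1 / i\<^sup>2\<close> is at most
  \<open>1 / (i - 1) - 1 / i\<close>. The subtracted \<open>1 / L\<close> makes the induction go
  through.\<close>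

lemma sum_inverse_squares_le:
  fixes k L :: nat
  assumes "1 \<le> k" "k \<le> L"
  shows "(\<Sum>i = k..L. 1 / (real i)\<^sup>2) \<le> 2 / k - 1 / L"
  using assms(2)
proof (induction L rule: dec_induct)
  case base
  show ?case using assms(1) by (auto simp: field_simps power2_eq_square)
next
  case (step L)
  have "1 / (real (Suc L))\<^sup>2 \<le> 1 / L - 1 / Suc L"
    using step assms(1) by (auto simp: divide_simps power2_eq_square)
  with step show ?case by simp
qed

lemma harm_le_ln: "1 \<le> n \<Longrightarrow> harm n \<le> 1 + ln (real n)"
proof (induction n rule: dec_induct)
  case base
  show ?case by (simp add: harm_expand)
next
  case (step n)
  have "ln (real n / (real n + 1)) \<le> real n / (real n + 1) - 1"
    using step by (intro ln_le_minus_one) auto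
  then have "inverse (real n + 1) \<le> ln (real n + 1) - ln (real n)"
    using step by (simp add: ln_div field_simps)
  with step show ?case by (simp add: harm_Suc add_ac)
qed

section \<open>The invariant and the locality of a run\<close>

lemma edges_of_Nil [simp]: "edges_of [] = {}"
  by (simp add: edges_of_def)

lemma edges_of_snoc: "edges_of (es @ [(a, b)]) = insert {a, b} (edges_of es)"
  by (simp add: edges_of_def)

lemma finite_edges_of [simp]: "finite (edges_of es)"
  by (simp add: edges_of_def)

lemma degree_in_insert:
  "finite E \<Longrightarrow> e \<notin> E \<Longrightarrow> degree_in (insert e E) x = (if x \<in> e then Suc (degree_in E x) else degree_in E x)"
proof -
  assume "finite E" "e \<notin> E"
  moreover have "{e' \<in> insert e E. x \<in> e'} =
      (if x \<in> e then insert e {e' \<in> E. x \<in> e'} else {e' \<in> E. x \<in> e'})"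
    by auto
  ultimately show ?thesis by (simp add: degree_in_def)
qed

lemma legal_stream_Nil: "legal_stream n L []"
  by (simp add: legal_stream_def degree_in_def)

lemma legal_stream_edgeD:
  assumes "legal_stream n L es" "{x, y} \<in> edges_of es"
  shows "x \<in> {1..n}" "y \<in> {1..n}" "x \<noteq> y"
proof -
  obtain a b where ab: "(a, b) \<in> set es" "{x, y} = {a, b}"
    using assms(2) by (auto simp: edges_of_def)
  then have "a \<in> {1..n}" "b \<in> {1..n}" "a \<noteq> b"
    using assms(1) by (auto simp: legal_stream_def)
  with ab(2) show "x \<in> {1..n}" "y \<in> {1..n}" "x \<noteq> y"
    by (auto simp: doubleton_eq_iff)
qed

lemma legal_stream_snocD:
  assumes "legal_stream n L (es @ [(a, b)])"
  shows "a \<in> {1..n}" "b \<in> {1..n}" "a \<noteq> b" "{a, b} \<notin> edges_of es"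
    "x \<in> {1..n} \<Longrightarrow> degree_in (insert {a, b} (edges_of es)) x \<le> L"
  using assms by (auto simp: legal_stream_def edges_of_def)

text \<open>The graph is simple, so an edge at \<open>x\<close> is determined by its other endpoint.
  This bound serves where \<open>L\<close> may exceed \<open>n\<close>.\<close>

lemma legal_stream_degree_le:
  assumes "legal_stream n L es"
  shows "degree_in (edges_of es) x \<le> n"
proof -
  have "{e \<in> edges_of es. x \<in> e} \<subseteq> (\<lambda>y. {x, y}) ` {1..n}"
  proof
    fix e assume "e \<in> {e \<in> edges_of es. x \<in> e}"
    then obtain a b where "e = {a, b}" "e \<in> edges_of es" "x \<in> e"
      by (auto simp: edges_of_def)
    then obtain y where "e = {x, y}" by auto
    then show "e \<in> (\<lambda>y. {x, y}) ` {1..n}"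
      using legal_stream_edgeD[OF assms, of x y] \<open>e \<in> edges_of es\<close> by auto
  qed
  then have "degree_in (edges_of es) x \<le> card ((\<lambda>y. {x, y}) ` {1..n})"
    unfolding degree_in_def by (intro card_mono) auto
  also have "\<dots> \<le> n" using card_image_le[of "{1..n}" "\<lambda>y. {x, y}"] by simp
  finally show ?thesis .
qed

lemma legal_stream_length_le:
  assumes "legal_stream n L es"
  shows "length es \<le> n\<^sup>2"
proof -
  have "distinct es" using assms by (auto simp: legal_stream_def distinct_map)
  moreover have "set es \<subseteq> {1..n} \<times> {1..n}" using assms by (auto simp: legal_stream_def)
  then have "card (set es) \<le> card ({1..n} \<times> {1..n})" by (intro card_mono) auto
  ultimately show ?thesis by (simp add: distinct_card power2_eq_square)
qed

section \<open>One step of the algorithm and the invariant\<close>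

definition upper :: "alg_state \<Rightarrow> nat \<times> nat \<Rightarrow> nat" where
  "upper s = (\<lambda>(a, b). if degs s b \<le> degs s a then a else b)"

definition lower :: "alg_state \<Rightarrow> nat \<times> nat \<Rightarrow> nat" where
  "lower s = (\<lambda>(a, b). if degs s b \<le> degs s a then b else a)"

definition next_level :: "alg_state \<Rightarrow> nat \<times> nat \<Rightarrow> nat" where
  "next_level s e = Suc (degs s (upper s e))"

definition next_stored :: "nat \<Rightarrow> color_lists \<Rightarrow> alg_state \<Rightarrow> nat \<times> nat \<Rightarrow> nat set set" where
  "next_stored L P s e =
     (if \<exists>i \<in> {next_level s e..L}. set (P (upper s e, i)) \<inter> set (P (lower s e, i)) \<noteq> {}
      then insert {upper s e, lower s e} (stored s) else stored s)"

definition next_degs :: "alg_state \<Rightarrow> nat \<times> nat \<Rightarrow> nat \<Rightarrow> nat" where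
  "next_degs s = (\<lambda>(a, b). (degs s)(a := Suc (degs s a), b := Suc (degs s b)))"

lemma upper_lower:
  "{upper s (a, b), lower s (a, b)} = {a, b}"
  "a \<noteq> b \<Longrightarrow> upper s (a, b) \<noteq> lower s (a, b)"
  "degs s (lower s e) \<le> degs s (upper s e)"
  by (auto simp: upper_def lower_def split: prod.splits)

lemma upper_lower_mem: "upper s (a, b) \<in> {a, b}" "lower s (a, b) \<in> {a, b}"
  by (auto simp: upper_def lower_def)

lemma process_edge_eq:
  assumes "a \<noteq> b"
  defines "e \<equiv> (a, b)"
  shows "process_edge L P e s =
    map_option (\<lambda>c. \<lparr>degs = next_degs s e, clr = (clr s)(upper s e := (next_level s e, c)),
                     stored = next_stored L P s e\<rparr>)
      (find (\<lambda>c. \<forall>w. {upper s e, w} \<in> next_stored L P s e \<longrightarrow> clr s w \<noteq> (next_level s e, c))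
         (P (upper s e, next_level s e)))"
proof -
  have *: "(\<lambda>c. (k, c) \<notin> {clr s w | w. {u, w} \<in> A}) =
      (\<lambda>c. \<forall>w. {u, w} \<in> A \<longrightarrow> clr s w \<noteq> (k, c))" for k u A
    by (auto simp: fun_eq_iff)
  let ?d = "(degs s)(a := degs s a + 1, b := degs s b + 1)"
  \<comment> \<open>\<open>process_edge\<close> compares the updated degrees, \<open>upper\<close>
    the old ones; both endpoints gain one, so the choice is the same, ties included. The maximum is
    then the new degree of \<open>upper s e\<close>.\<close>
  have uv: "(if ?d b \<le> ?d a then (a, b) else (b, a)) = (upper s e, lower s e)"
    and k: "max (next_level s e) (?d (lower s e)) = next_level s e"
      "?d (upper s e) = next_level s e"
    and d: "?d = next_degs s e"
    using assms(1) by (auto simp: e_def upper_def lower_def next_level_def next_degs_def)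
  have "process_edge L P e s =
    (case find (\<lambda>c. (next_level s e, c) \<notin> {clr s w | w. {upper s e, w} \<in> next_stored L P s e})
         (P (upper s e, next_level s e)) of None \<Rightarrow> None
     | Some c \<Rightarrow> Some \<lparr>degs = ?d, clr = (clr s)(upper s e := (next_level s e, c)),
                     stored = next_stored L P s e\<rparr>)"
    unfolding process_edge_def Let_def
    by (subst e_def) (unfold prod.case uv k next_stored_def, rule refl)
  then show ?thesis
    unfolding * d by (simp add: map_option_case)
qed

text \<open>In the clause on unstored edges, \<open>k\<close> stands for the level at which the edge
  arrived; the clause persists because the levels of colors never decrease. The pair
  \<open>(0, 0)\<close> marks a vertex not yet colored, as real levels start at 1.\<close>

definition alg_inv :: "nat \<Rightarrow> color_lists \<Rightarrow> alg_state \<Rightarrow> (nat \<times> nat) list \<Rightarrow> bool" where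
  "alg_inv L P s es \<longleftrightarrow>
     (\<forall>x. degs s x = degree_in (edges_of es) x) \<and>
     (\<forall>x. clr s x = (0, 0) \<or>
        1 \<le> fst (clr s x) \<and> fst (clr s x) \<le> degs s x \<and> snd (clr s x) \<in> set (P (x, fst (clr s x)))) \<and>
     stored s \<subseteq> edges_of es \<and>
     (\<forall>x y. {x, y} \<in> edges_of es \<longrightarrow> {x, y} \<notin> stored s \<longrightarrow>
        (\<exists>k. (k \<le> fst (clr s x) \<or> k \<le> fst (clr s y)) \<and>
             (\<forall>i \<in> {k..L}. set (P (x, i)) \<inter> set (P (y, i)) = {}))) \<and>
     proper_coloring (edges_of es) (clr s)"

lemma alg_inv_init: "alg_inv L P init_state []"
  by (auto simp: alg_inv_def init_state_def degree_in_def proper_coloring_def)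

lemma alg_inv_level_le: "alg_inv L P s es \<Longrightarrow> fst (clr s x) \<le> degs s x"
  unfolding alg_inv_def by (metis fst_conv le0)

lemma next_level_le:
  assumes "alg_inv L P s es" "legal_stream n L (es @ [e])"
  shows "1 \<le> next_level s e" "next_level s e \<le> L" "next_level s e \<le> n"
    "next_level s e = degree_in (edges_of (es @ [e])) (upper s e)" "upper s e \<in> {1..n}"
proof -
  obtain a b where e: "e = (a, b)" by force
  note D = legal_stream_snocD[OF assms(2)[unfolded e]]
  show "upper s e \<in> {1..n}" using D(1,2) by (auto simp: e upper_def)
  moreover show eq: "next_level s e = degree_in (edges_of (es @ [e])) (upper s e)"
    using assms(1) D(3,4) upper_lower_mem[of s a b]
    by (auto simp: e next_level_def edges_of_snoc degree_in_insert alg_inv_def)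
  ultimately show "next_level s e \<le> L" using D(5) by (simp add: e edges_of_snoc)
  show "next_level s e \<le> n" using eq legal_stream_degree_le[OF assms(2)] by simp
  show "1 \<le> next_level s e" by (simp add: next_level_def)
qed

text \<open>
  An edge that was not stored at level \<open>k\<close> or above cannot cause a conflict at level \<open>k\<close>, so
  that testing a new color against the stored neighbors amounts to testing it against all of them.
\<close>
lemma conflict_imp_stored:
  assumes inv: "alg_inv L P s es" and legal: "legal_stream n L (es @ [e])"
    and c: "c \<in> set (P (upper s e, next_level s e))"
    and w: "{upper s e, w} \<in> edges_of (es @ [e])" "clr s w = (next_level s e, c)"
  shows "{upper s e, w} \<in> next_stored L P s e"
proof (rule ccontr)
  assume notin: "{upper s e, w} \<notin> next_stored L P s e"
  obtain a b where e: "e = (a, b)" by force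
  let ?u = "upper s e" and ?k = "next_level s e"
  have kL: "?k \<le> L" using next_level_le[OF inv legal] by simp
  \<comment> \<open>\<open>next_level\<close> is a successor, so the color of \<open>w\<close> is
    not the initial \<open>(0, 0)\<close> and comes from the list of \<open>w\<close> at this
    level.\<close>
  have cw: "c \<in> set (P (w, ?k))"
    using inv w(2) unfolding alg_inv_def next_level_def by (metis Suc_neq_Zero fst_conv snd_conv)
  have meet: "set (P (?u, ?k)) \<inter> set (P (w, ?k)) \<noteq> {}" using c cw by auto
  show False
  proof (cases "{?u, w} = {?u, lower s e}")
    case True
    \<comment> \<open>The arriving edge itself: a shared color at its own level already causes it to
      be stored.\<close>
    then have "w = lower s e" by (auto simp: doubleton_eq_iff)
    then have "{?u, w} \<in> next_stored L P s e"
      using meet kL unfolding next_stored_def by auto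
    with notin show False by simp
  next
    case False
    then have E: "{?u, w} \<in> edges_of es"
      using w(1) upper_lower(1)[of s a b] by (simp add: e edges_of_snoc)
    moreover have "{?u, w} \<notin> stored s" using notin by (auto simp: next_stored_def split: if_splits)
    ultimately obtain k where k: "k \<le> fst (clr s ?u) \<or> k \<le> fst (clr s w)"
      "\<forall>i \<in> {k..L}. set (P (?u, i)) \<inter> set (P (w, i)) = {}"
      using inv unfolding alg_inv_def by blast
    \<comment> \<open>Both endpoints have colors of level at most \<open>?k\<close>, hence the
      disjointness from \<open>k\<close> on covers level \<open>?k\<close>.\<close>
    have "fst (clr s ?u) \<le> ?k" using alg_inv_level_le[OF inv, of ?u] by (simp add: next_level_def)
    then have "k \<le> ?k" using k(1) w(2) by auto
    with k(2) kL meet show False by auto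
  qed
qed

lemma next_stored_subset:
  assumes "alg_inv L P s es"
  shows "next_stored L P s e \<subseteq> edges_of (es @ [e])"
proof -
  obtain a b where e: "e = (a, b)" by force
  show ?thesis using assms upper_lower(1)[of s a b]
    by (auto simp: alg_inv_def next_stored_def e edges_of_snoc)
qed

text \<open>By \<open>conflict_imp_stored\<close>, a candidate color passes the test against all
  neighbors exactly if it passes the test against the stored ones. The new color thus depends on the
  degrees, the colors, the stream and one single list.\<close>

lemma process_edge_full:
  assumes inv: "alg_inv L P s es" and legal: "legal_stream n L (es @ [e])"
  shows "process_edge L P e s =
    map_option (\<lambda>c. \<lparr>degs = next_degs s e, clr = (clr s)(upper s e := (next_level s e, c)),
                     stored = next_stored L P s e\<rparr>)
      (find (\<lambda>c. \<forall>w. {upper s e, w} \<in> edges_of (es @ [e]) \<longrightarrow> clr s w \<noteq> (next_level s e, c))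
         (P (upper s e, next_level s e)))"
proof -
  obtain a b where e: "e = (a, b)" by force
  have ne: "a \<noteq> b" using legal_stream_snocD[OF legal[unfolded e]] by simp
  have "find (\<lambda>c. \<forall>w. {upper s e, w} \<in> next_stored L P s e \<longrightarrow> clr s w \<noteq> (next_level s e, c))
         (P (upper s e, next_level s e)) =
      find (\<lambda>c. \<forall>w. {upper s e, w} \<in> edges_of (es @ [e]) \<longrightarrow> clr s w \<noteq> (next_level s e, c))
         (P (upper s e, next_level s e))"
    by (rule find_cong)
       (use conflict_imp_stored[OF inv legal] next_stored_subset[OF inv, of e] in blast)+
  then show ?thesis using process_edge_eq[OF ne, of L P s] by (simp add: e)
qed

lemma process_edge_SomeD:
  assumes "alg_inv L P s es" "legal_stream n L (es @ [e])" "process_edge L P e s = Some s'"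
  shows "degs s' = next_degs s e" "stored s' = next_stored L P s e"
    "\<exists>c. c \<in> set (P (upper s e, next_level s e)) \<and>
       clr s' = (clr s)(upper s e := (next_level s e, c)) \<and>
       (\<forall>w. {upper s e, w} \<in> edges_of (es @ [e]) \<longrightarrow> clr s w \<noteq> (next_level s e, c))"
proof -
  obtain c where "find (\<lambda>c. \<forall>w. {upper s e, w} \<in> edges_of (es @ [e]) \<longrightarrow> clr s w \<noteq> (next_level s e, c))
         (P (upper s e, next_level s e)) = Some c"
    and s': "s' = \<lparr>degs = next_degs s e, clr = (clr s)(upper s e := (next_level s e, c)),
                     stored = next_stored L P s e\<rparr>"
    using assms(3) unfolding process_edge_full[OF assms(1,2)] by auto
  then have "c \<in> set (P (upper s e, next_level s e)) \<and>
      (\<forall>w. {upper s e, w} \<in> edges_of (es @ [e]) \<longrightarrow> clr s w \<noteq> (next_level s e, c))"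
    unfolding find_Some_iff by (metis nth_mem)
  then show "degs s' = next_degs s e" "stored s' = next_stored L P s e"
    "\<exists>c. c \<in> set (P (upper s e, next_level s e)) \<and>
       clr s' = (clr s)(upper s e := (next_level s e, c)) \<and>
       (\<forall>w. {upper s e, w} \<in> edges_of (es @ [e]) \<longrightarrow> clr s w \<noteq> (next_level s e, c))"
    unfolding s' by auto
qed

lemma alg_inv_step:
  assumes inv: "alg_inv L P s es" and legal: "legal_stream n L (es @ [e])"
    and s': "process_edge L P e s = Some s'"
  shows "alg_inv L P s' (es @ [e])"
proof -
  obtain a b where e: "e = (a, b)" by force
  note D = legal_stream_snocD[OF legal[unfolded e]]
  let ?u = "upper s e" and ?v = "lower s e" and ?k = "next_level s e"
  note S = process_edge_SomeD[OF inv legal s']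
  obtain c where c: "c \<in> set (P (?u, ?k))" "clr s' = (clr s)(?u := (?k, c))"
    "\<forall>w. {?u, w} \<in> edges_of (es @ [e]) \<longrightarrow> clr s w \<noteq> (?k, c)"
    using S(3) by auto
  have uv: "{?u, ?v} = {a, b}" "?u \<noteq> ?v" using upper_lower(1)[of s a b] upper_lower(2)[OF D(3), of s] by (auto simp: e)
  have E: "edges_of (es @ [e]) = insert {?u, ?v} (edges_of es)"
    using uv by (simp add: e edges_of_snoc)
  \<comment> \<open>The recolored vertex gets its new degree as level, which exceeds the level of
    its old color.\<close>
  have lev: "fst (clr s x) \<le> fst (clr s' x)" for x
    using alg_inv_level_le[OF inv, of ?u] c(2) by (simp add: next_level_def)
  have deg: "degs s' x = degree_in (edges_of (es @ [e])) x" for x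
    using inv D(3,4) by (auto simp: S next_degs_def e edges_of_snoc degree_in_insert alg_inv_def)
  have degmono: "degs s x \<le> degs s' x" for x
    by (auto simp: S next_degs_def e)
  have clr: "clr s' x = (0, 0) \<or> 1 \<le> fst (clr s' x) \<and> fst (clr s' x) \<le> degs s' x \<and>
      snd (clr s' x) \<in> set (P (x, fst (clr s' x)))" for x
  proof (cases "x = ?u")
    case True
    have "?k = degs s' ?u" using deg next_level_le[OF inv legal] by simp
    with True c show ?thesis by (auto simp: next_level_def)
  next
    case False
    then have "clr s' x = clr s x" using c(2) by simp
    moreover have "clr s x = (0, 0) \<or> 1 \<le> fst (clr s x) \<and> fst (clr s x) \<le> degs s x \<and>
      snd (clr s x) \<in> set (P (x, fst (clr s x)))"
      using inv unfolding alg_inv_def by blast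
    ultimately show ?thesis using degmono[of x] by auto
  qed
  have unst: "\<exists>k. (k \<le> fst (clr s' x) \<or> k \<le> fst (clr s' y)) \<and>
             (\<forall>i \<in> {k..L}. set (P (x, i)) \<inter> set (P (y, i)) = {})"
    if xy: "{x, y} \<in> edges_of (es @ [e])" "{x, y} \<notin> stored s'" for x y
  proof (cases "{x, y} = {?u, ?v}")
    case True
    \<comment> \<open>The new edge was not stored, and \<open>?u\<close> now has a color of exactly
      the arrival level, which is the witness for \<open>k\<close>.\<close>
    then have "\<forall>i \<in> {?k..L}. set (P (?u, i)) \<inter> set (P (?v, i)) = {}"
      using xy(2) by (auto simp: S next_stored_def split: if_splits)
    moreover have "fst (clr s' ?u) = ?k" using c(2) by simp
    moreover have "x = ?u \<and> y = ?v \<or> x = ?v \<and> y = ?u" using True by (auto simp: doubleton_eq_iff)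
    ultimately show ?thesis by (intro exI[of _ ?k]) (auto simp: Int_commute)
  next
    case False
    then have "{x, y} \<in> edges_of es" "{x, y} \<notin> stored s"
      using xy by (auto simp: E S next_stored_def split: if_splits)
    then obtain k where "k \<le> fst (clr s x) \<or> k \<le> fst (clr s y)"
      "\<forall>i \<in> {k..L}. set (P (x, i)) \<inter> set (P (y, i)) = {}"
      using inv unfolding alg_inv_def by blast
    then show ?thesis using lev[of x] lev[of y] by (meson le_trans)
  qed
  have ppr: "clr s' x \<noteq> clr s' y" if xy: "{x, y} \<in> edges_of (es @ [e])" for x y
  proof -
    have ne: "x \<noteq> y" using legal_stream_edgeD[OF legal xy] by simp
    consider "x = ?u" | "y = ?u" | "x \<noteq> ?u" "y \<noteq> ?u" by blast
    then show ?thesis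
    proof cases
      case 1
      then show ?thesis using c(2,3) xy ne by auto
    next
      case 2
      then show ?thesis using c(2,3) xy ne by (auto simp: insert_commute)
    next
      case 3
      then have "{x, y} \<in> edges_of es" using xy by (auto simp: E doubleton_eq_iff)
      then show ?thesis using inv 3 c(2) by (auto simp: alg_inv_def proper_coloring_def)
    qed
  qed
  show ?thesis
    unfolding alg_inv_def proper_coloring_def
    using deg clr unst ppr next_stored_subset[OF inv, of e] by (auto simp: S)
qed

section \<open>Runs against an adaptive adversary\<close>

lemma run_inv:
  assumes "legal_adversary n L adv" "run L P adv t = Some (s, es, cs)"
  shows "alg_inv L P s es" "legal_stream n L es" "length cs = length es"
    "map (\<lambda>t. adv (take t cs)) [0..<length cs] = map Some es"
    "adv cs = Some e \<Longrightarrow> legal_stream n L (es @ [e])"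
proof -
  have next_legal: "legal_stream n L (es @ [e])"
    if "length cs = length es" "map (\<lambda>t. adv (take t cs)) [0..<length cs] = map Some es"
      "adv cs = Some e" for cs es e
  proof -
    have "map (\<lambda>t. adv (take t cs)) [0..<Suc (length cs)] = map Some (es @ [e])"
      using that by simp
    then show ?thesis using assms(1) unfolding legal_adversary_def by blast
  qed
  have "alg_inv L P s es \<and> legal_stream n L es \<and> length cs = length es \<and>
    map (\<lambda>t. adv (take t cs)) [0..<length cs] = map Some es"
    using assms(2)
  proof (induction t arbitrary: s es cs)
    case 0
    then show ?case by (simp add: alg_inv_init legal_stream_Nil)
  next
    case (Suc t)
    then obtain s0 es0 cs0 where r: "run L P adv t = Some (s0, es0, cs0)"
      by (auto split: option.splits)
    note IH = Suc.IH[OF r]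
    show ?case
    proof (cases "adv cs0")
      case None
      with Suc.prems r IH show ?thesis by auto
    next
      case (Some e)
      then obtain s' where s': "process_edge L P e s0 = Some s'"
        using Suc.prems r by (auto split: option.splits)
      then have eqs: "s = s'" "es = es0 @ [e]" "cs = cs0 @ [clr s']"
        using Suc.prems r Some by auto
      have legal: "legal_stream n L (es0 @ [e])" using next_legal IH Some by blast
      \<comment> \<open>Each earlier edge depends on a proper prefix of the answers, so appending a
        coloring leaves it unchanged.\<close>
      have "map (\<lambda>t. adv (take t (cs0 @ [clr s']))) [0..<length cs0] =
          map (\<lambda>t. adv (take t cs0)) [0..<length cs0]"
        by (intro map_cong) auto
      also have "\<dots> = map Some es0" using IH by blast
      finally have "map (\<lambda>t. adv (take t cs)) [0..<length cs] = map Some es"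
        using Some conjunct1[OF conjunct2[OF conjunct2[OF IH]]] by (simp add: eqs)
      then show ?thesis using alg_inv_step[OF _ legal s'] IH legal by (simp add: eqs)
    qed
  qed
  then show "alg_inv L P s es" "legal_stream n L es" "length cs = length es"
    "map (\<lambda>t. adv (take t cs)) [0..<length cs] = map Some es"
    "adv cs = Some e \<Longrightarrow> legal_stream n L (es @ [e])"
    using next_legal by blast+
qed

lemma run_None_mono:
  assumes "run L P adv t = None" "t \<le> t'"
  shows "run L P adv t' = None"
  using assms(2,1) by (induction t' rule: dec_induct) auto

lemma run_stops:
  assumes "run L P adv t = Some (s, es, cs)" "adv cs = None" "t \<le> t'"
  shows "run L P adv t' = Some (s, es, cs)"
  using assms(3) by (induction t' rule: dec_induct) (use assms in auto)

lemma run_length: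
  assumes "run L P adv t = Some (s, es, cs)"
  shows "length es = t \<or> adv cs = None"
  using assms by (induction t arbitrary: s es cs) (auto split: option.splits)

text \<open>A legal stream has at most \<open>n\<^sup>2\<close> edges, so by then the adversary has
  stopped. Statements about all rounds thus reduce to finitely many.\<close>

lemma run_eq_at_square:
  assumes "legal_adversary n L adv" "run L P adv (Suc (n\<^sup>2)) \<noteq> None" "Suc (n\<^sup>2) \<le> t"
  shows "run L P adv t = run L P adv (Suc (n\<^sup>2))"
proof -
  obtain s es cs where r: "run L P adv (Suc (n\<^sup>2)) = Some (s, es, cs)"
    using assms(2) by auto
  have "length es \<le> n\<^sup>2" using legal_stream_length_le run_inv[OF assms(1) r] by blast
  then have "adv cs = None" using run_length[OF r] by auto
  then show ?thesis using run_stops[OF r _ assms(3)] r by simp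
qed

text \<open>
  The edges stored at \<open>v\<close> do depend on its lists at higher levels, but they do not influence the
  colors, by the lemma \<open>process_edge_full\<close>.
\<close>
lemma run_local:
  assumes adv: "legal_adversary n L adv"
    and "run L P adv t = Some (s, es, cs)"
    and "\<And>x i. x \<noteq> v \<or> i \<le> degs s v \<Longrightarrow> P' (x, i) = P (x, i)"
  shows "\<exists>s'. run L P' adv t = Some (s', es, cs) \<and> degs s' = degs s \<and> clr s' = clr s \<and>
    (\<forall>e. v \<notin> e \<longrightarrow> (e \<in> stored s' \<longleftrightarrow> e \<in> stored s))"
  using assms(2,3)
proof (induction t arbitrary: s es cs)
  case 0
  then show ?case by auto
next
  case (Suc t)
  then obtain s0 es0 cs0 where r: "run L P adv t = Some (s0, es0, cs0)"
    by (auto split: option.splits)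
  show ?case
  proof (cases "adv cs0")
    case None
    then have "s = s0" "es = es0" "cs = cs0" using Suc.prems(1) r by auto
    with Suc.IH[OF r] Suc.prems(2) None show ?thesis by auto
  next
    case (Some e)
    then obtain s1 where s1: "process_edge L P e s0 = Some s1"
      using Suc.prems(1) r by (auto split: option.splits)
    then have eqs: "s = s1" "es = es0 @ [e]" "cs = cs0 @ [clr s1]"
      using Suc.prems(1) r Some by auto
    obtain a b where e: "e = (a, b)" by force
    note I = run_inv[OF adv r]
    note legal = I(5)[OF Some]
    note S = process_edge_SomeD[OF I(1) legal s1]
    have agree: "P' (x, i) = P (x, i)" if "x \<noteq> v \<or> i \<le> next_degs s0 e v" for x i
      using Suc.prems(2) that by (simp add: eqs S)
    have "next_degs s0 e v \<ge> degs s0 v" by (auto simp: next_degs_def e)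
    then obtain s0' where r': "run L P' adv t = Some (s0', es0, cs0)"
      and d: "degs s0' = degs s0" and c: "clr s0' = clr s0"
      and st: "\<forall>e. v \<notin> e \<longrightarrow> (e \<in> stored s0' \<longleftrightarrow> e \<in> stored s0)"
      using Suc.IH[OF r] agree by (meson le_trans)
    have ul: "upper s0' = upper s0" "lower s0' = lower s0" "next_level s0' = next_level s0"
      "next_degs s0' = next_degs s0"
      using d by (auto simp: fun_eq_iff upper_def lower_def next_level_def next_degs_def)
    \<comment> \<open>If the recolored vertex is \<open>v\<close>, it uses its list at its new
      degree, which the agreement of \<open>P'\<close> and \<open>P\<close> still covers.\<close>
    have lev: "next_level s0 e = next_degs s0 e (upper s0 e)"
      using legal_stream_snocD(3)[OF legal[unfolded e]]
      by (auto simp: next_level_def next_degs_def e upper_def)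
    have Peq: "P' (upper s0 e, next_level s0 e) = P (upper s0 e, next_level s0 e)"
      by (rule agree) (use lev in auto)
    note F = process_edge_full[OF I(1) legal]
    note F' = process_edge_full[OF run_inv(1)[OF adv r'] legal]
    obtain c1 where c1: "find (\<lambda>c. \<forall>w. {upper s0 e, w} \<in> edges_of (es0 @ [e]) \<longrightarrow>
        clr s0 w \<noteq> (next_level s0 e, c)) (P (upper s0 e, next_level s0 e)) = Some c1"
      and s1_eq: "s1 = \<lparr>degs = next_degs s0 e,
        clr = (clr s0)(upper s0 e := (next_level s0 e, c1)), stored = next_stored L P s0 e\<rparr>"
      using s1 unfolding F by auto
    let ?s = "\<lparr>degs = next_degs s0 e, clr = (clr s0)(upper s0 e := (next_level s0 e, c1)),
        stored = next_stored L P' s0' e\<rparr>"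
    have "process_edge L P' e s0' = Some ?s"
      unfolding F' ul c Peq c1 by simp
    moreover have "f \<in> next_stored L P' s0' e \<longleftrightarrow> f \<in> next_stored L P s0 e" if "v \<notin> f" for f
    proof (cases "f = {upper s0 e, lower s0 e}")
      case True
      then have "P' (upper s0 e, i) = P (upper s0 e, i)" "P' (lower s0 e, i) = P (lower s0 e, i)" for i
        using that by (auto intro!: agree)
      then show ?thesis using st that by (auto simp: next_stored_def ul)
    next
      case False
      then show ?thesis using st that by (auto simp: next_stored_def ul)
    qed
    ultimately show ?thesis
      using r' Some by (simp add: eqs s1_eq fun_upd_def)
  qed
qed

section \<open>Aborts and stored edges\<close>

lemma lists_pmf_supportD:
  assumes "P \<in> set_pmf (lists_pmf n L)" "x \<in> {1..n}" "i \<in> {1..L}"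
  shows "length (P (x, i)) = list_len n" "set (P (x, i)) \<subseteq> {1..2 * i\<^sup>2}"
proof -
  have "P (x, i) \<in> set_pmf (replicate_pmf (list_len n) (pmf_of_set {1..2 * i\<^sup>2}))"
    using assms set_Pi_pmf_subset'[of "{1..n} \<times> {1..L}" "[]"]
    by (fastforce simp: lists_pmf_def PiE_dflt_def)
  moreover have "set_pmf (pmf_of_set {1..2 * i\<^sup>2}) = {1..2 * i\<^sup>2}"
    using assms(3) by (intro set_pmf_of_set) auto
  ultimately show "length (P (x, i)) = list_len n" "set (P (x, i)) \<subseteq> {1..2 * i\<^sup>2}"
    by (auto simp: set_replicate_pmf)
qed

section \<open>Probability of an abort\<close>

lemma card_neighbors_le:
  assumes "finite E"
  shows "card {w. {u, w} \<in> E} \<le> degree_in E u" "finite {w. {u, w} \<in> E}"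
proof -
  have inj: "inj_on (\<lambda>w. {u, w}) {w. {u, w} \<in> E}"
    by (auto simp: inj_on_def doubleton_eq_iff)
  have sub: "(\<lambda>w. {u, w}) ` {w. {u, w} \<in> E} \<subseteq> {e \<in> E. u \<in> e}" by auto
  show "finite {w. {u, w} \<in> E}"
    using assms by (intro finite_imageD[OF finite_subset[OF sub] inj]) auto
  show "card {w. {u, w} \<in> E} \<le> degree_in E u"
    unfolding degree_in_def using assms sub inj by (intro card_inj_on_le) auto
qed

text \<open>All lists but the one of \<open>u\<close> at level \<open>k\<close> are held fixed. The
  history until \<open>u\<close> is to be recolored at level \<open>k\<close> does not involve that
  list, so the set of blocked colors is fixed too, and an abort forces all \<open>list_len n\<close>
  fresh samples into it.\<close>

lemma abort_emeasure_le:
  assumes adv: "legal_adversary n L adv" and u: "u \<in> {1..n}" and k: "k \<in> {1..L}"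
  shows "emeasure (measure_pmf (lists_pmf n L))
     {P. \<exists>t s es cs e. run L P adv t = Some (s, es, cs) \<and> adv cs = Some e \<and>
        process_edge L P e s = None \<and> upper s e = u \<and> next_level s e = k}
   \<le> ennreal ((1 / 2) ^ list_len n)" (is "emeasure _ ?X \<le> _")
  unfolding lists_pmf_def
proof (rule emeasure_Pi_pmf_resample_le[where i = "(u, k)"])
  fix P :: color_lists
  let ?p = "replicate_pmf (list_len n) (pmf_of_set {1..2 * k\<^sup>2})"
  have "emeasure (measure_pmf ?p) {x. P((u, k) := x) \<in> ?X} \<le> ennreal ((1 / 2) ^ list_len n)"
  proof (cases "{x. P((u, k) := x) \<in> ?X} = {}")
    case False
    \<comment> \<open>One aborting list \<open>x0\<close> provides the reference history; the set
      \<open>S\<close> of blocked colors is read off from it.\<close>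
    then obtain x0 t0 s0 es0 cs0 e0 where r0: "run L (P((u, k) := x0)) adv t0 = Some (s0, es0, cs0)"
      and a0: "adv cs0 = Some e0" and abort0: "process_edge L (P((u, k) := x0)) e0 s0 = None"
      and u0: "upper s0 e0 = u" and k0: "next_level s0 e0 = k"
      by blast
    define E where "E = edges_of (es0 @ [e0])"
    define S where "S = {c. \<exists>w. {u, w} \<in> E \<and> clr s0 w = (k, c)}"
    note I0 = run_inv[OF adv r0]
    note legal = I0(5)[OF a0]
    have degE: "degree_in E u = k"
      using next_level_le(4)[OF I0(1) legal] u0 k0 by (simp add: E_def)
    have S_sub: "S \<subseteq> (\<lambda>w. snd (clr s0 w)) ` {w. {u, w} \<in> E}"
      unfolding S_def by force
    have finE: "finite {w. {u, w} \<in> E}" "card {w. {u, w} \<in> E} \<le> k"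
      using card_neighbors_le[of E u] degE by (auto simp: E_def)
    have finS: "finite S" using S_sub finE finite_surj by blast
    have cardS: "card S \<le> k"
      using surj_card_le[OF finE(1) S_sub] finE(2) by linarith
    have "{x. P((u, k) := x) \<in> ?X} \<subseteq> {x. set x \<subseteq> S}"
    proof (intro subsetI CollectI)
      fix x c assume x: "x \<in> {x. P((u, k) := x) \<in> ?X}" and c: "c \<in> set x"
      then obtain t s es cs e where r: "run L (P((u, k) := x)) adv t = Some (s, es, cs)"
        and a: "adv cs = Some e" and abort: "process_edge L (P((u, k) := x)) e s = None"
        and u': "upper s e = u" and k': "next_level s e = k"
        by blast
      \<comment> \<open>The two families differ only at level \<open>k\<close>, above the current
        degree of \<open>u\<close>, so each run transfers to the other family.\<close>
      have "\<exists>s'. run L (P((u, k) := x)) adv t0 = Some (s', es0, cs0) \<and> degs s' = degs s0 \<and>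
          clr s' = clr s0 \<and> (\<forall>e. u \<notin> e \<longrightarrow> (e \<in> stored s' \<longleftrightarrow> e \<in> stored s0))"
        by (rule run_local[OF adv r0]) (use u0 k0 in \<open>auto simp: next_level_def\<close>)
      then obtain s' where r1: "run L (P((u, k) := x)) adv t0 = Some (s', es0, cs0)"
        and s': "clr s' = clr s0" by blast
      have "\<exists>s'. run L (P((u, k) := x0)) adv t = Some (s', es, cs) \<and> degs s' = degs s \<and>
          clr s' = clr s \<and> (\<forall>e. u \<notin> e \<longrightarrow> (e \<in> stored s' \<longleftrightarrow> e \<in> stored s))"
        by (rule run_local[OF adv r]) (use u' k' in \<open>auto simp: next_level_def\<close>)
      then have r2: "run L (P((u, k) := x0)) adv t \<noteq> None" by auto
      \<comment> \<open>Each run survives up to the abort of the other, so both abort in the same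
        round with the same history.\<close>
      have "run L (P((u, k) := x0)) adv (Suc t0) = None" using r0 a0 abort0 by simp
      then have "t \<le> t0" using r2 run_None_mono by (metis not_less_eq_eq)
      moreover have "run L (P((u, k) := x)) adv (Suc t) = None" using r a abort by simp
      then have "t0 \<le> t" using r1 run_None_mono by (metis not_less_eq_eq option.distinct(1))
      ultimately have eqs: "s' = s" "es0 = es" "cs0 = cs" "e0 = e" using r r1 a a0 by auto
      have "\<exists>w. {u, w} \<in> E \<and> clr s w = (k, c)"
        using abort c unfolding process_edge_full[OF run_inv(1)[OF adv r] run_inv(5)[OF adv r a]]
        by (auto simp: u' k' find_None_iff E_def eqs)
      then show "c \<in> S" using s' by (simp add: S_def eqs)
    qed
    then have "emeasure (measure_pmf ?p) {x. P((u, k) := x) \<in> ?X} \<le>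
        emeasure (measure_pmf ?p) {x. set x \<subseteq> S}"
      by (intro emeasure_mono) auto
    also have "\<dots> = ennreal (measure_pmf.prob (pmf_of_set {1..2 * k\<^sup>2}) S ^ list_len n)"
      by (simp add: measure_pmf.emeasure_eq_measure measure_replicate_pmf_subset)
    also have "\<dots> \<le> ennreal ((1 / 2) ^ list_len n)"
    proof (intro ennreal_leI power_mono)
      have "measure_pmf.prob (pmf_of_set {1..2 * k\<^sup>2}) S \<le> card S / card {1..2 * k\<^sup>2}"
        using k finS by (intro measure_pmf_of_set_le) auto
      also have "\<dots> \<le> k / (2 * k\<^sup>2)" using cardS by (simp add: divide_right_mono)
      also have "\<dots> \<le> 1 / 2" using k by (auto simp: field_simps power2_eq_square)
      finally show "measure_pmf.prob (pmf_of_set {1..2 * k\<^sup>2}) S \<le> 1 / 2" .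
    qed auto
    finally show ?thesis .
  next
    case True
    show ?thesis unfolding True by simp
  qed
  then show "emeasure (measure_pmf (case (u, k) of (x, i) \<Rightarrow>
      replicate_pmf (list_len n) (pmf_of_set {1..2 * i\<^sup>2}))) {x. P((u, k) := x) \<in> ?X}
      \<le> ennreal ((1 / 2) ^ list_len n)" by simp
qed (use u k in auto)

section \<open>Stored edges: the exponential supermartingale\<close>

lemma prob_lists_meet_le:
  assumes P: "P \<in> set_pmf (lists_pmf n L)" and u: "u \<in> {1..n}" and k: "1 \<le> k"
  shows "measure_pmf.prob
      (Pi_pmf ({v} \<times> {k..L}) [] (\<lambda>(x, i). replicate_pmf (list_len n) (pmf_of_set {1..2 * i\<^sup>2})))
      {Q. \<exists>i \<in> {k..L}. set (P (u, i)) \<inter> set (Q (v, i)) \<noteq> {}} \<le> (real (list_len n))\<^sup>2 / k"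
    (is "measure_pmf.prob ?M _ \<le> _")
proof (cases "k \<le> L")
  case True
  let ?l = "real (list_len n)"
  \<comment> \<open>Each of the \<open>?l\<close> fresh colors hits one of the at most
    \<open>?l\<close> colors of \<open>u\<close> with probability at most
    \<open>?l / (2 * i\<^sup>2)\<close>.\<close>
  have one: "measure_pmf.prob ?M {Q. set (P (u, i)) \<inter> set (Q (v, i)) \<noteq> {}} \<le> ?l\<^sup>2 / 2 * (1 / (real i)\<^sup>2)"
    if i: "i \<in> {k..L}" for i
  proof -
    let ?p = "replicate_pmf (list_len n) (pmf_of_set {1..2 * i\<^sup>2})"
    have i1: "1 \<le> i" using i k by simp
    have "measure_pmf.prob ?M {Q. set (P (u, i)) \<inter> set (Q (v, i)) \<noteq> {}} =
       measure_pmf.prob (map_pmf (\<lambda>Q. Q (v, i)) ?M) {xs. set xs \<inter> set (P (u, i)) \<noteq> {}}"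
      by (simp add: vimage_def Int_commute)
    also have "map_pmf (\<lambda>Q. Q (v, i)) ?M = ?p"
      using i by (subst Pi_pmf_component) auto
    also have "measure_pmf.prob ?p {xs. set xs \<inter> set (P (u, i)) \<noteq> {}} \<le>
        ?l * measure_pmf.prob (pmf_of_set {1..2 * i\<^sup>2}) (set (P (u, i)))"
      by (rule measure_replicate_pmf_meets)
    also have "\<dots> \<le> ?l * (card (set (P (u, i))) / card {1..2 * i\<^sup>2})"
      using i1 by (intro mult_left_mono measure_pmf_of_set_le) auto
    also have "\<dots> \<le> ?l * (?l / (2 * (real i)\<^sup>2))"
      using card_length[of "P (u, i)"] lists_pmf_supportD(1)[OF P u, of i] i k
      by (intro mult_left_mono) (auto intro!: divide_right_mono)
    finally show ?thesis by (simp add: power2_eq_square)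
  qed
  have "measure_pmf.prob ?M {Q. \<exists>i \<in> {k..L}. set (P (u, i)) \<inter> set (Q (v, i)) \<noteq> {}} =
      measure_pmf.prob ?M (\<Union>i \<in> {k..L}. {Q. set (P (u, i)) \<inter> set (Q (v, i)) \<noteq> {}})"
    by (rule arg_cong2[where f = measure]) auto
  also have "\<dots> \<le> (\<Sum>i = k..L. measure_pmf.prob ?M {Q. set (P (u, i)) \<inter> set (Q (v, i)) \<noteq> {}})"
    by (rule measure_UNION_le) auto
  also have "\<dots> \<le> (\<Sum>i = k..L. ?l\<^sup>2 / 2 * (1 / (real i)\<^sup>2))"
    by (rule sum_mono) (rule one)
  also have "\<dots> = ?l\<^sup>2 / 2 * (\<Sum>i = k..L. 1 / (real i)\<^sup>2)"
    by (simp add: sum_distrib_left)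
  also have "\<dots> \<le> ?l\<^sup>2 / 2 * (2 / k)"
    using sum_inverse_squares_le[OF k True] by (intro mult_left_mono) (auto intro: order_trans)
  finally show ?thesis by simp
next
  case False
  then show ?thesis by simp
qed

text \<open>Which lists are to be resampled depends on the history; splitting along the finitely
  many values of \<open>f\<close> permits a separate argument for each.\<close>

lemma nn_integral_le_by_cases:
  fixes M :: "'a pmf"
  assumes "finite K" "\<And>x. x \<in> set_pmf M \<Longrightarrow> f x \<in> K"
    and le: "\<And>\<kappa>. \<kappa> \<in> K \<Longrightarrow> (\<integral>\<^sup>+x. indicator {x. f x = \<kappa>} x * h x \<partial>measure_pmf M) \<le>
       (\<integral>\<^sup>+x. indicator {x. f x = \<kappa>} x * g x \<partial>measure_pmf M)"
  shows "(\<integral>\<^sup>+x. h x \<partial>measure_pmf M) \<le> (\<integral>\<^sup>+x. g x \<partial>measure_pmf M)"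
proof -
  have eq: "(\<integral>\<^sup>+x. h x \<partial>measure_pmf M) = (\<Sum>\<kappa>\<in>K. \<integral>\<^sup>+x. indicator {x. f x = \<kappa>} x * h x \<partial>measure_pmf M)"
    for h :: "'a \<Rightarrow> ennreal"
  proof -
    have "h x = (\<Sum>\<kappa>\<in>K. indicator {x. f x = \<kappa>} x * h x)" if "x \<in> set_pmf M" for x
    proof -
      have "(\<Sum>\<kappa>\<in>K. indicator {x. f x = \<kappa>} x * h x) = (\<Sum>\<kappa>\<in>K. if f x = \<kappa> then h x else 0)"
        by (intro sum.cong) auto
      then show ?thesis using assms(1,2) that by simp
    qed
    then have "(\<integral>\<^sup>+x. h x \<partial>measure_pmf M) =
        (\<integral>\<^sup>+x. (\<Sum>\<kappa>\<in>K. indicator {x. f x = \<kappa>} x * h x) \<partial>measure_pmf M)"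
      by (intro nn_integral_cong_AE) (simp add: AE_measure_pmf_iff)
    then show ?thesis by (simp add: nn_integral_sum)
  qed
  show ?thesis unfolding eq[of h] eq[of g] by (rule sum_mono) (rule le)
qed

text \<open>
  A supermartingale along the run: each stored edge at \<open>u\<close> doubles the weight, and the
  exponential factor pays for the probability at most \<open>q / j\<close> of storing the \<open>j\<close>-th edge at \<open>u\<close>.
\<close>
definition weight :: "real \<Rightarrow> nat \<Rightarrow> alg_state \<Rightarrow> real" where
  "weight q u s = 2 ^ degree_in (stored s) u * exp (- q * harm (degs s u))"

text \<open>An abort counts as weight 0, so it can only lower the expectation.\<close>

definition run_weight :: "real \<Rightarrow> nat \<Rightarrow> nat \<Rightarrow> adversary \<Rightarrow> nat \<Rightarrow> color_lists \<Rightarrow> ennreal" where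
  "run_weight q u L adv t P =
     (case run L P adv t of None \<Rightarrow> 0 | Some (s, _, _) \<Rightarrow> ennreal (weight q u s))"

text \<open>
  The other endpoint of the next edge, if that edge contains \<open>u\<close>, and the larger of the two new
  degrees.
\<close>
definition next_partner :: "nat \<Rightarrow> nat \<Rightarrow> adversary \<Rightarrow> nat \<Rightarrow> color_lists \<Rightarrow> (nat \<times> nat) option" where
  "next_partner u L adv t P =
     (case run L P adv t of None \<Rightarrow> None
      | Some (s, _, cs) \<Rightarrow>
          (case adv cs of None \<Rightarrow> None
           | Some e \<Rightarrow>
               if u = upper s e then Some (lower s e, next_level s e)
               else if u = lower s e then Some (upper s e, next_level s e) else None))"

lemma next_partner_SomeE:
  assumes "next_partner u L adv t P = Some (v, k)"
  obtains s es cs e where "run L P adv t = Some (s, es, cs)" "adv cs = Some e"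
    "{upper s e, lower s e} = {u, v}" "next_level s e = k"
  using assms unfolding next_partner_def
  by (auto split: option.splits if_splits) (metis insert_commute)

lemma next_partner_bounds:
  assumes adv: "legal_adversary n L adv" and "next_partner u L adv t P = Some (v, k)"
  shows "v \<in> {1..n}" "k \<in> {1..L}"
proof -
  obtain s es cs e where r: "run L P adv t = Some (s, es, cs)" "adv cs = Some e"
    "{upper s e, lower s e} = {u, v}" "next_level s e = k"
    using assms(2) by (rule next_partner_SomeE)
  obtain a b where e: "e = (a, b)" by force
  note I = run_inv[OF adv r(1)]
  note legal = I(5)[OF r(2)]
  show "k \<in> {1..L}" using next_level_le[OF I(1) legal] r(4) by auto
  have "v \<in> {a, b}" using r(3) upper_lower_mem[of s a b] by (auto simp: e)
  then show "v \<in> {1..n}" using legal_stream_snocD[OF legal[unfolded e]] by auto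
qed

text \<open>An edge avoiding \<open>u\<close> changes neither the stored edges at \<open>u\<close>
  nor its degree, and an abort lowers the weight to 0.\<close>

lemma run_weight_Suc_le_None:
  assumes adv: "legal_adversary n L adv" and key: "next_partner u L adv t P = None"
  shows "run_weight q u L adv (Suc t) P \<le> run_weight q u L adv t P"
proof (cases "run L P adv t")
  case (Some x)
  then obtain s es cs where r: "run L P adv t = Some (s, es, cs)" by (cases x) auto
  show ?thesis
  proof (cases "adv cs")
    case (Some e)
    obtain a b where e: "e = (a, b)" by force
    note I = run_inv[OF adv r]
    note legal = I(5)[OF Some]
    have u: "u \<noteq> upper s e" "u \<noteq> lower s e"
      using key r Some by (auto simp: next_partner_def split: if_splits)
    then have u': "u \<noteq> a" "u \<noteq> b" using upper_lower(1)[of s a b] by (auto simp: e)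
    show ?thesis
    proof (cases "process_edge L P e s")
      case s': (Some s')
      note S = process_edge_SomeD[OF I(1) legal s']
      have "{f \<in> stored s'. u \<in> f} = {f \<in> stored s. u \<in> f}"
        using u by (auto simp: S next_stored_def)
      moreover have "degs s' u = degs s u" using u' by (simp add: S next_degs_def e)
      ultimately show ?thesis
        using r Some s' by (simp add: run_weight_def weight_def degree_in_def)
    qed (use r Some in \<open>simp add: run_weight_def\<close>)
  qed (use r in \<open>simp add: run_weight_def\<close>)
qed (simp add: run_weight_def)

text \<open>The degree of \<open>v\<close> is below \<open>k\<close>, so its lists from level
  \<open>k\<close> on have not influenced the colorings; with all other lists fixed, the edge is
  stored with probability at most \<open>q / k\<close>. Doubling the weight in that event costs a
  factor \<open>1 + q / k\<close> in expectation, for which one more term of the harmonic number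
  pays.\<close>

lemma run_weight_Suc_le_Some:
  assumes adv: "legal_adversary n L adv" and u: "u \<in> {1..n}"
    and P: "P \<in> set_pmf (lists_pmf n L)"
    and key: "next_partner u L adv t P = Some (v, k)"
  defines "q \<equiv> (real (list_len n))\<^sup>2"
  shows "(\<integral>\<^sup>+Q. run_weight q u L adv (Suc t) (\<lambda>x. if x \<in> {v} \<times> {k..L} then Q x else P x)
      \<partial>Pi_pmf ({v} \<times> {k..L}) [] (\<lambda>(x, i). replicate_pmf (list_len n) (pmf_of_set {1..2 * i\<^sup>2})))
    \<le> run_weight q u L adv t P" (is "(\<integral>\<^sup>+Q. run_weight _ _ _ _ _ (?ov Q) \<partial>?M) \<le> _")
proof -
  obtain s es cs e where r: "run L P adv t = Some (s, es, cs)" and a: "adv cs = Some e"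
    and uv: "{upper s e, lower s e} = {u, v}" and k: "next_level s e = k"
    using key by (rule next_partner_SomeE)
  obtain a' b where e: "e = (a', b)" by force
  note I = run_inv[OF adv r]
  note legal = I(5)[OF a]
  note D = legal_stream_snocD[OF legal[unfolded e]]
  have uv': "{u, v} = {a', b}" using uv upper_lower(1)[of s a' b] by (simp add: e)
  have ne: "u \<noteq> v" using uv' D(3) by auto
  have dv: "degs s v < k" and du: "degs s u < k"
    using k uv upper_lower(3)[of s e] by (auto simp: next_level_def doubleton_eq_iff)
  define Y where "Y = {Q. \<exists>i \<in> {k..L}. set (P (u, i)) \<inter> set (Q (v, i)) \<noteq> {}}"
  let ?w = "2 ^ degree_in (stored s) u * exp (- q * harm (Suc (degs s u))) :: real"
  have step: "run_weight q u L adv (Suc t) (?ov Q) \<le> ennreal ?w * (1 + indicator Y Q)" for Q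
  proof -
    have "\<exists>s'. run L (?ov Q) adv t = Some (s', es, cs) \<and> degs s' = degs s \<and> clr s' = clr s \<and>
        (\<forall>e. v \<notin> e \<longrightarrow> (e \<in> stored s' \<longleftrightarrow> e \<in> stored s))"
      by (rule run_local[OF adv r]) (use dv in auto)
    then obtain s' where r': "run L (?ov Q) adv t = Some (s', es, cs)" and d: "degs s' = degs s"
      and st: "\<And>e. v \<notin> e \<Longrightarrow> e \<in> stored s' \<longleftrightarrow> e \<in> stored s" by blast
    note I' = run_inv[OF adv r']
    have ul: "upper s' = upper s" "lower s' = lower s" "next_level s' = next_level s"
      using d by (auto simp: fun_eq_iff upper_def lower_def next_level_def)
    \<comment> \<open>\<open>run_local\<close> controls only stored edges avoiding \<open>v\<close>.
      As the edge joining \<open>u\<close> and \<open>v\<close> is new, no earlier edge at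
      \<open>u\<close> contains \<open>v\<close>.\<close>
    have notboth: "v \<notin> f" if f: "u \<in> f" "f \<in> edges_of es" for f
    proof
      assume "v \<in> f"
      obtain x y where "f = {x, y}" using f(2) by (auto simp: edges_of_def)
      then have "f = {a', b}" using f(1) \<open>v \<in> f\<close> ne uv' by auto
      with f(2) D(4) show False by simp
    qed
    have "stored s' \<subseteq> edges_of es" "stored s \<subseteq> edges_of es"
      using I(1) I'(1) by (auto simp: alg_inv_def)
    then have same: "{f \<in> stored s'. u \<in> f} = {f \<in> stored s. u \<in> f}"
      using st notboth by blast
    show ?thesis
    proof (cases "process_edge L (?ov Q) e s'")
      case None
      then show ?thesis using r' a by (simp add: run_weight_def)
    next
      case (Some s'')
      note S = process_edge_SomeD[OF I'(1) legal Some]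
      have du'': "degs s'' u = Suc (degs s u)"
        using uv' D(3) d by (auto simp: S next_degs_def e doubleton_eq_iff)
      have "degree_in (stored s'') u \<le> degree_in (stored s) u + indicator Y Q"
      proof (cases "Q \<in> Y")
        case True
        have "{f \<in> stored s''. u \<in> f} \<subseteq> insert {u, v} {f \<in> stored s. u \<in> f}"
          using same uv by (auto simp: S next_stored_def ul split: if_splits)
        moreover have "finite (stored s)"
          using \<open>stored s \<subseteq> edges_of es\<close> finite_edges_of finite_subset by blast
        ultimately have "degree_in (stored s'') u \<le> card (insert {u, v} {f \<in> stored s. u \<in> f})"
          unfolding degree_in_def by (intro card_mono) auto
        also have "\<dots> \<le> Suc (degree_in (stored s) u)"
          unfolding degree_in_def by (rule card_insert_le_m1) auto
        finally show ?thesis using True by simp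
      next
        case False
        then have "\<forall>i \<in> {k..L}. set (?ov Q (u, i)) \<inter> set (?ov Q (v, i)) = {}"
          using ne by (auto simp: Y_def)
        moreover have "upper s e = u \<and> lower s e = v \<or> upper s e = v \<and> lower s e = u"
          using uv by (auto simp: doubleton_eq_iff)
        ultimately have "\<forall>i \<in> {k..L}. set (?ov Q (upper s e, i)) \<inter> set (?ov Q (lower s e, i)) = {}"
          by (elim disjE conjE) (simp_all only: Int_commute)
        then have "stored s'' = stored s'"
          unfolding S(2) next_stored_def ul k by meson
        then show ?thesis using same False by (simp add: degree_in_def)
      qed
      then have "(2::real) ^ degree_in (stored s'') u \<le> 2 ^ (degree_in (stored s) u + indicator Y Q)"
        by (intro power_increasing) auto
      also have "\<dots> = 2 ^ degree_in (stored s) u * (1 + indicator Y Q)"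
        by (auto simp: indicator_def)
      finally have "weight q u s'' \<le> ?w * (1 + indicator Y Q)"
        by (simp add: weight_def du'' mult.commute mult.left_commute mult_left_mono)
      then have "ennreal (weight q u s'') \<le> ennreal (?w * (1 + indicator Y Q))"
        by (rule ennreal_leI)
      also have "\<dots> = ennreal ?w * (1 + indicator Y Q)"
        by (subst ennreal_mult) (auto simp: indicator_def)
      finally show ?thesis using r' a Some by (simp add: run_weight_def)
    qed
  qed
  have "(\<integral>\<^sup>+Q. run_weight q u L adv (Suc t) (?ov Q) \<partial>?M) \<le>
      (\<integral>\<^sup>+Q. ennreal ?w * (1 + indicator Y Q) \<partial>?M)"
    by (rule nn_integral_mono) (rule step)
  also have "\<dots> = ennreal ?w * (1 + emeasure ?M Y)"
    by (simp add: nn_integral_cmult nn_integral_add)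
  also have "\<dots> \<le> ennreal ?w * (1 + ennreal (q / k))"
  proof (intro mult_left_mono add_left_mono)
    have "1 \<le> k" using du by simp
    then show "emeasure ?M Y \<le> ennreal (q / k)"
      unfolding measure_pmf.emeasure_eq_measure Y_def q_def
      by (intro ennreal_leI prob_lists_meet_le[OF P u])
  qed auto
  also have "\<dots> = ennreal (?w * (1 + q / k))"
    by (simp add: ennreal_mult q_def flip: ennreal_plus ennreal_1)
  also have "\<dots> \<le> ennreal (weight q u s)"
  proof (rule ennreal_leI)
    \<comment> \<open>The new degree of \<open>u\<close> is at most \<open>k\<close>, so
      \<open>exp (q / k)\<close> is at most the factor by which the exponential part of the weight
      drops.\<close>
    have "1 + q / k \<le> exp (q / k)" by (rule exp_ge_add_one_self)
    also have "\<dots> \<le> exp (q * inverse (real (Suc (degs s u))))"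
      using du by (auto simp: q_def divide_inverse intro!: mult_left_mono le_imp_inverse_le)
    finally have "?w * (1 + q / k) \<le> ?w * exp (q * inverse (real (Suc (degs s u))))"
      by (intro mult_left_mono) auto
    also have "\<dots> = weight q u s"
      by (simp add: weight_def harm_Suc algebra_simps flip: exp_add)
    finally show "?w * (1 + q / k) \<le> weight q u s" .
  qed
  also have "\<dots> = run_weight q u L adv t P" using r by (simp add: run_weight_def)
  finally show ?thesis .
qed

text \<open>Induction over the rounds; each value \<open>Some (v, k)\<close> of
  \<open>next_partner\<close> has its own block of lists to resample.\<close>

lemma nn_integral_run_weight_le_1:
  assumes adv: "legal_adversary n L adv" and u: "u \<in> {1..n}"
  shows "(\<integral>\<^sup>+P. run_weight ((real (list_len n))\<^sup>2) u L adv t P \<partial>lists_pmf n L) \<le> 1"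
proof (induction t)
  case 0
  show ?case by (simp add: run_weight_def weight_def init_state_def degree_in_def harm_def)
next
  case (Suc t)
  let ?q = "(real (list_len n))\<^sup>2"
  let ?K = "insert None (Some ` ({1..n} \<times> {1..L}))"
  let ?W = "run_weight ?q u L adv"
  let ?key = "next_partner u L adv t"
  have "(\<integral>\<^sup>+P. ?W (Suc t) P \<partial>lists_pmf n L) \<le> (\<integral>\<^sup>+P. ?W t P \<partial>lists_pmf n L)"
  proof (rule nn_integral_le_by_cases[where K = ?K and f = ?key])
    show "?key P \<in> ?K" for P
      using next_partner_bounds[OF adv, of u t P] by (cases "?key P") auto
    fix \<kappa> assume \<kappa>: "\<kappa> \<in> ?K"
    show "(\<integral>\<^sup>+P. indicator {P. ?key P = \<kappa>} P * ?W (Suc t) P \<partial>lists_pmf n L) \<le>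
        (\<integral>\<^sup>+P. indicator {P. ?key P = \<kappa>} P * ?W t P \<partial>lists_pmf n L)"
    proof (cases \<kappa>)
      case None
      then show ?thesis
        using run_weight_Suc_le_None[OF adv]
        by (intro nn_integral_mono) (auto simp: indicator_def)
    next
      case (Some vk)
      then obtain v k where vk: "\<kappa> = Some (v, k)" "v \<in> {1..n}" "k \<in> {1..L}"
        using \<kappa> by auto
      show ?thesis
        unfolding lists_pmf_def
      proof (rule nn_integral_Pi_pmf_resample_le[where B = "{v} \<times> {k..L}"])
        fix P assume "P \<in> set_pmf (Pi_pmf ({1..n} \<times> {1..L}) []
          (\<lambda>(x, i). replicate_pmf (list_len n) (pmf_of_set {1..2 * i\<^sup>2})))"
        then have P: "P \<in> set_pmf (lists_pmf n L)" by (simp add: lists_pmf_def)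
        let ?ov = "\<lambda>Q x. if x \<in> {v} \<times> {k..L} then Q x else P x"
        let ?M = "Pi_pmf ({v} \<times> {k..L}) []
          (\<lambda>(x, i). replicate_pmf (list_len n) (pmf_of_set {1..2 * i\<^sup>2}))"
        show "(\<integral>\<^sup>+Q. indicator {P. ?key P = \<kappa>} (?ov Q) * ?W (Suc t) (?ov Q) \<partial>?M) \<le>
            indicator {P. ?key P = \<kappa>} P * ?W t P"
        proof (cases "?key P = \<kappa>")
          case True
          have "(\<integral>\<^sup>+Q. indicator {P. ?key P = \<kappa>} (?ov Q) * ?W (Suc t) (?ov Q) \<partial>?M) \<le>
              (\<integral>\<^sup>+Q. ?W (Suc t) (?ov Q) \<partial>?M)"
            by (intro nn_integral_mono) (auto simp: indicator_def)
          also have "\<dots> \<le> ?W t P"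
            by (rule run_weight_Suc_le_Some[OF adv u P]) (use True vk in simp)
          finally show ?thesis using True by simp
        next
          case False
          \<comment> \<open>If resampled lists gave \<open>\<kappa>\<close>, transferring their run
            back to \<open>P\<close> would give \<open>\<kappa>\<close> there as well. So the
            indicator vanishes for every \<open>Q\<close>.\<close>
          have "?key (?ov Q) \<noteq> \<kappa>" for Q
          proof
            assume "?key (?ov Q) = \<kappa>"
            then obtain s es cs e where r: "run L (?ov Q) adv t = Some (s, es, cs)"
              and a: "adv cs = Some e" and uv: "{upper s e, lower s e} = {u, v}"
              and k: "next_level s e = k"
              unfolding vk(1) by (rule next_partner_SomeE)
            have dv: "degs s v < k"
              using k uv upper_lower(3)[of s e] by (auto simp: next_level_def doubleton_eq_iff)
            have "\<exists>s'. run L P adv t = Some (s', es, cs) \<and> degs s' = degs s \<and> clr s' = clr s \<and>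
                (\<forall>e. v \<notin> e \<longrightarrow> (e \<in> stored s' \<longleftrightarrow> e \<in> stored s))"
              by (rule run_local[OF adv r]) (use dv in auto)
            then obtain s' where r': "run L P adv t = Some (s', es, cs)" and d: "degs s' = degs s"
              by blast
            have "upper s' = upper s" "lower s' = lower s" "next_level s' = next_level s"
              using d by (auto simp: fun_eq_iff upper_def lower_def next_level_def)
            then have "?key P = ?key (?ov Q)" using r r' by (simp add: next_partner_def split: option.split)
            with \<open>?key (?ov Q) = \<kappa>\<close> False show False by simp
          qed
          then show ?thesis by simp
        qed
      qed (use vk in auto)
    qed
  qed auto
  also note Suc
  finally show ?case .
qed

text \<open>Markov's inequality for the weight: degrees are at most \<open>n\<close>, so
  \<open>r\<close> stored edges at \<open>u\<close> force a weight of at least the reciprocal of the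
  claimed bound.\<close>

lemma prob_many_stored_le:
  fixes r :: real
  assumes adv: "legal_adversary n L adv" and u: "u \<in> {1..n}"
  shows "measure_pmf.prob (lists_pmf n L)
      {P. \<exists>s es cs. run L P adv t = Some (s, es, cs) \<and> r \<le> degree_in (stored s) u}
    \<le> exp ((real (list_len n))\<^sup>2 * harm n) / 2 powr r" (is "measure_pmf.prob _ ?X \<le> ?c")
proof -
  let ?q = "(real (list_len n))\<^sup>2"
  have "indicator ?X P \<le> ennreal ?c * run_weight ?q u L adv t P" for P
  proof (cases "P \<in> ?X")
    case True
    then obtain s es cs where r: "run L P adv t = Some (s, es, cs)" "r \<le> degree_in (stored s) u"
      by blast
    note I = run_inv[OF adv r(1)]
    have "degs s u \<le> n"
      using I(1) legal_stream_degree_le[OF I(2)] by (simp add: alg_inv_def)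
    then have "?q * harm (degs s u) \<le> ?q * harm n" by (intro mult_left_mono harm_mono) auto
    then have 1: "exp (- ?q * harm n) \<le> exp (- ?q * harm (degs s u))" by simp
    have 2: "2 powr r \<le> 2 ^ degree_in (stored s) u"
      using r(2) by (simp add: powr_mono flip: powr_realpow)
    have "1 = ?c * (2 powr r * exp (- ?q * harm n))"
      by (simp add: exp_minus field_simps)
    also have "\<dots> \<le> ?c * weight ?q u s"
      unfolding weight_def using 1 2 by (intro mult_left_mono mult_mono) auto
    finally have "ennreal 1 \<le> ennreal (?c * weight ?q u s)" by (rule ennreal_leI)
    also have "\<dots> = ennreal ?c * ennreal (weight ?q u s)"
      by (rule ennreal_mult) (auto simp: weight_def)
    finally show ?thesis using True r(1) by (simp add: run_weight_def)
  qed simp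
  then have "(\<integral>\<^sup>+P. indicator ?X P \<partial>lists_pmf n L) \<le>
      (\<integral>\<^sup>+P. ennreal ?c * run_weight ?q u L adv t P \<partial>lists_pmf n L)"
    by (intro nn_integral_mono)
  also have "\<dots> = ennreal ?c * (\<integral>\<^sup>+P. run_weight ?q u L adv t P \<partial>lists_pmf n L)"
    by (simp add: nn_integral_cmult)
  also have "\<dots> \<le> ennreal ?c * 1"
    by (intro mult_left_mono nn_integral_run_weight_le_1[OF adv u]) auto
  finally have "emeasure (measure_pmf (lists_pmf n L)) ?X \<le> ennreal ?c" by simp
  then show ?thesis by (simp add: measure_pmf.emeasure_eq_measure)
qed

section \<open>Bit counts and the main bound\<close>

lemma log2_ge_1: "2 \<le> n \<Longrightarrow> 1 \<le> log 2 (real n)"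
  by (simp add: le_log_iff)

lemma list_len_bounds:
  assumes "2 \<le> n"
  shows "4 * log 2 (real n) \<le> list_len n" "list_len n \<le> 5 * log 2 (real n)"
proof -
  have "real (list_len n) = of_int \<lceil>4 * log 2 (real n)\<rceil>"
    using log2_ge_1[OF assms] by (simp add: list_len_def)
  then show "4 * log 2 (real n) \<le> list_len n" "list_len n \<le> 5 * log 2 (real n)"
    using log2_ge_1[OF assms] by linarith+
qed

lemma random_bits_le:
  assumes n: "2 \<le> n" and L: "L \<le> n" and P: "P \<in> set_pmf (lists_pmf n L)"
  shows "real (random_bits n L P) \<le> 20 * (real n * real L) * log 2 (real n) ^ 2"
proof -
  let ?l = "log 2 (real n)"
  note l = log2_ge_1[OF n]
  have one: "real (length (P (x, i)) * nat \<lceil>log 2 (2 * (real i)\<^sup>2)\<rceil>) \<le> 20 * ?l ^ 2"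
    if "x \<in> {1..n}" "i \<in> {1..L}" for x i
  proof -
    have len: "real (length (P (x, i))) \<le> 5 * ?l"
      using lists_pmf_supportD(1)[OF P that] list_len_bounds(2)[OF n] by simp
    have i: "1 \<le> real i" "real i \<le> n" using that L by auto
    \<comment> \<open>This is at most \<open>1 + 2 * ?l\<close>, and rounding up adds less than 1;
      with \<open>1 \<le> ?l\<close> the result is at most \<open>4 * ?l\<close>.\<close>
    have "log 2 (2 * (real i)\<^sup>2) = 1 + 2 * log 2 (real i)"
      using i by (simp add: log_mult log_nat_power)
    moreover have "0 \<le> log 2 (real i)" "log 2 (real i) \<le> ?l" using i by auto
    ultimately have "real (nat \<lceil>log 2 (2 * (real i)\<^sup>2)\<rceil>) \<le> 4 * ?l" using l by linarith
    then have "real (length (P (x, i))) * real (nat \<lceil>log 2 (2 * (real i)\<^sup>2)\<rceil>) \<le> 5 * ?l * (4 * ?l)"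
      using len l by (intro mult_mono) auto
    then show ?thesis by (simp add: power2_eq_square)
  qed
  have "real (random_bits n L P) =
      (\<Sum>x = 1..n. \<Sum>i = 1..L. real (length (P (x, i)) * nat \<lceil>log 2 (2 * (real i)\<^sup>2)\<rceil>))"
    by (simp add: random_bits_def)
  also have "\<dots> \<le> (\<Sum>x = 1..n. \<Sum>i = 1..L. 20 * ?l ^ 2)"
    by (intro sum_mono one)
  finally show ?thesis by (simp add: mult_ac)
qed

lemma code_len_le:
  assumes "real m + 1 \<le> M"
  shows "real (code_len m) \<le> 2 * log 2 M + 1"
proof -
  have "0 \<le> log 2 (real m + 1)" "log 2 (real m + 1) \<le> log 2 M" using assms by auto
  then show ?thesis unfolding code_len_def by simp linarith
qed

lemma color_support:
  assumes adv: "legal_adversary n L adv" and P: "P \<in> set_pmf (lists_pmf n L)"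
    and r: "run L P adv t = Some (s, es, cs)" and x: "x \<in> {1..n}"
  shows "clr s x = (0, 0) \<or>
    fst (clr s x) \<in> {1..degs s x} \<and> snd (clr s x) \<in> {1..2 * (degs s x)\<^sup>2}"
proof -
  note I = run_inv[OF adv r]
  let ?i = "fst (clr s x)"
  have "degs s x \<le> L" using I(1,2) x by (auto simp: alg_inv_def legal_stream_def)
  moreover have "clr s x = (0, 0) \<or> 1 \<le> ?i \<and> ?i \<le> degs s x \<and> snd (clr s x) \<in> set (P (x, ?i))"
    using I(1) unfolding alg_inv_def by blast
  moreover have "?i\<^sup>2 \<le> (degs s x)\<^sup>2" if "?i \<le> degs s x" using that by (intro power_mono) auto
  ultimately show ?thesis
  proof (elim disjE conjE)
    assume *: "degs s x \<le> L" "1 \<le> ?i" "?i \<le> degs s x" "snd (clr s x) \<in> set (P (x, ?i))"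
      and sq: "?i \<le> degs s x \<Longrightarrow> ?i\<^sup>2 \<le> (degs s x)\<^sup>2"
    then have "snd (clr s x) \<in> {1..2 * ?i\<^sup>2}"
      using lists_pmf_supportD(2)[OF P x, of ?i] by auto
    moreover have "2 * ?i\<^sup>2 \<le> 2 * (degs s x)\<^sup>2" using sq[OF *(3)] by linarith
    ultimately have "snd (clr s x) \<in> {1..2 * (degs s x)\<^sup>2}" unfolding atLeastAtMost_iff by linarith
    with * show ?thesis by simp
  qed simp
qed

text \<open>There are at most \<open>?D\<close> levels with at most \<open>2 * ?D\<^sup>2\<close>
  colors each, plus the initial color \<open>(0, 0)\<close>. Because of the maximum with 1, the
  latter is absorbed into the constant even for the empty graph.\<close>

lemma card_colors_le:
  assumes adv: "legal_adversary n L adv" and P: "P \<in> set_pmf (lists_pmf n L)"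
    and r: "run L P adv t = Some (s, es, cs)"
  shows "real (card (clr s ` {1..n})) \<le> 3 * real (max 1 (max_degree n (edges_of es))) ^ 3"
proof -
  let ?D = "max 1 (max_degree n (edges_of es))"
  note I = run_inv[OF adv r]
  have "clr s x \<in> insert (0, 0) ({1..?D} \<times> {1..2 * ?D\<^sup>2})" if x: "x \<in> {1..n}" for x
  proof -
    have "degs s x \<le> max_degree n (edges_of es)"
      using I(1) x unfolding max_degree_def alg_inv_def by (intro Max_ge) auto
    then have d: "degs s x \<le> ?D" by simp
    then have "(degs s x)\<^sup>2 \<le> ?D\<^sup>2" by (intro power_mono) auto
    then show ?thesis using color_support[OF adv P r x] d
      by (cases "clr s x") (auto simp del: max.bounded_iff intro: order_trans)
  qed
  then have "clr s ` {1..n} \<subseteq> insert (0, 0) ({1..?D} \<times> {1..2 * ?D\<^sup>2})" by blast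
  then have "card (clr s ` {1..n}) \<le> card (insert (0, 0) ({1..?D} \<times> {1..2 * ?D\<^sup>2}))"
    by (intro card_mono) auto
  also have "\<dots> \<le> Suc (card ({1..?D} \<times> {1..2 * ?D\<^sup>2}))" by (rule card_insert_le_m1) auto
  also have "\<dots> = 1 + 2 * ?D ^ 3" by (simp add: power2_eq_square power3_eq_cube)
  also have "\<dots> \<le> 3 * ?D ^ 3" using one_le_power[of ?D 3] by simp
  finally show ?thesis using of_nat_mono[of _ "3 * ?D ^ 3", where 'a = real] by simp
qed

text \<open>Each vertex costs at most \<open>19 * ?l\<close> bits (5 + 5 + 9), the edge count
  \<open>9 * ?l\<close>, and each of the at most \<open>n * (200 * ?l ^ 3)\<close> stored edges
  \<open>10 * ?l\<close>. The resulting constant 2028 is rounded up.\<close>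

lemma state_bits_le:
  assumes n: "2 \<le> n" and adv: "legal_adversary n L adv" and P: "P \<in> set_pmf (lists_pmf n L)"
    and r: "run L P adv t = Some (s, es, cs)"
    and few: "\<And>u. u \<in> {1..n} \<Longrightarrow> real (degree_in (stored s) u) \<le> 200 * log 2 (real n) ^ 3"
  shows "real (state_bits n s) \<le> 2100 * (real n * log 2 (real n) ^ 4)"
proof -
  let ?l = "log 2 (real n)"
  note l = log2_ge_1[OF n]
  note I = run_inv[OF adv r]
  have st: "stored s \<subseteq> edges_of es" using I(1) by (simp add: alg_inv_def)
  have lin: "real (code_len m) \<le> 2 * ?l + 3" if "m \<le> n" for m
  proof -
    have "real (code_len m) \<le> 2 * log 2 (2 * real n) + 1" using that n by (intro code_len_le) auto
    then show ?thesis using n by (simp add: log_mult)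
  qed
  have quad: "real (code_len m) \<le> 4 * ?l + 5" if "m \<le> 2 * n\<^sup>2" for m
  proof -
    have "real m \<le> 2 * (real n)\<^sup>2" using of_nat_mono[OF that, where 'a = real] by simp
    moreover have "1 \<le> (real n)\<^sup>2" using n by (intro one_le_power) auto
    ultimately have "real (code_len m) \<le> 2 * log 2 (4 * (real n)\<^sup>2) + 1" by (intro code_len_le) auto
    moreover have "log 2 (4 * (real n)\<^sup>2) = 2 + 2 * ?l"
      using n log_pow_cancel[of 2 2] by (simp add: log_mult log_nat_power)
    ultimately show ?thesis by simp
  qed
  have vertex: "real (code_len (degs s x) + code_len (fst (clr s x)) + code_len (snd (clr s x)))
      \<le> 19 * ?l" if x: "x \<in> {1..n}" for x
  proof -
    have d: "degs s x \<le> n" using I(1) legal_stream_degree_le[OF I(2)] by (simp add: alg_inv_def)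
    then have sq: "2 * (degs s x)\<^sup>2 \<le> 2 * n\<^sup>2" by (intro mult_left_mono power_mono) auto
    have "fst (clr s x) \<le> n" using color_support[OF adv P r x] d by auto
    moreover have "snd (clr s x) \<le> 2 * (degs s x)\<^sup>2" using color_support[OF adv P r x] by auto
    then have "snd (clr s x) \<le> 2 * n\<^sup>2" using sq by (rule order_trans)
    ultimately have "fst (clr s x) \<le> n" "snd (clr s x) \<le> 2 * n\<^sup>2" .
    then show ?thesis using lin[OF d] lin[of "fst (clr s x)"] quad[of "snd (clr s x)"] l by simp
  qed
  have edge: "real (\<Sum>x \<in> e. code_len x) \<le> 10 * ?l" if eS: "e \<in> stored s" for e
  proof -
    obtain a b where e: "e = {a, b}" using eS st by (auto simp: edges_of_def)
    then have "a \<le> n" "b \<le> n" "a \<noteq> b"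
      using legal_stream_edgeD[OF I(2), of a b] eS st by auto
    moreover from this have "real (\<Sum>x \<in> e. code_len x) = real (code_len a) + real (code_len b)"
      by (simp add: e)
    ultimately show ?thesis using lin[of a] lin[of b] l by linarith
  qed
  have "stored s = (\<Union>u \<in> {1..n}. {e \<in> stored s. u \<in> e})"
  proof (intro equalityI subsetI)
    fix e assume e: "e \<in> stored s"
    then obtain a b where ab: "e = {a, b}" using st by (auto simp: edges_of_def)
    then have "a \<in> {1..n}" using legal_stream_edgeD(1)[OF I(2), of a b] e st by blast
    then show "e \<in> (\<Union>u \<in> {1..n}. {e \<in> stored s. u \<in> e})" using e ab by blast
  qed auto
  then have "card (stored s) \<le> (\<Sum>u = 1..n. degree_in (stored s) u)"
    unfolding degree_in_def using card_UN_le[of "{1..n}" "\<lambda>u. {e \<in> stored s. u \<in> e}"] by simp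
  then have "real (card (stored s)) \<le> (\<Sum>u = 1..n. real (degree_in (stored s) u))"
    using of_nat_mono[where 'a = real] by fastforce
  also have "\<dots> \<le> (\<Sum>u = 1..n. 200 * ?l ^ 3)" by (intro sum_mono few)
  finally have card: "real (card (stored s)) \<le> real n * (200 * ?l ^ 3)" by simp
  have "card (stored s) \<le> card (edges_of es)" using st by (intro card_mono) auto
  also have "\<dots> \<le> length es" unfolding edges_of_def
    by (rule order_trans[OF card_image_le card_length]) auto
  also have "\<dots> \<le> 2 * n\<^sup>2" using legal_stream_length_le[OF I(2)] by simp
  finally have cnt: "real (code_len (card (stored s))) \<le> 9 * ?l" using quad l by fastforce
  have "real (\<Sum>e \<in> stored s. \<Sum>x \<in> e. code_len x) = (\<Sum>e \<in> stored s. real (\<Sum>x \<in> e. code_len x))"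
    by simp
  also have "\<dots> \<le> (\<Sum>e \<in> stored s. 10 * ?l)" by (intro sum_mono edge)
  also have "\<dots> = real (card (stored s)) * (10 * ?l)" by simp
  also have "\<dots> \<le> real n * (200 * ?l ^ 3) * (10 * ?l)" using card l by (intro mult_right_mono) auto
  also have "\<dots> = 2000 * (real n * ?l ^ 4)" by (simp add: power3_eq_cube power4_eq_xxxx)
  finally have edges: "real (\<Sum>e \<in> stored s. \<Sum>x \<in> e. code_len x) \<le> 2000 * (real n * ?l ^ 4)" .
  have "(\<Sum>x = 1..n. real (code_len (degs s x) + code_len (fst (clr s x)) + code_len (snd (clr s x))))
      \<le> (\<Sum>x = 1..n. 19 * ?l)"
    by (intro sum_mono vertex)
  then have "real (state_bits n s) \<le> 19 * (real n * ?l) + 9 * ?l + 2000 * (real n * ?l ^ 4)"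
    using cnt edges by (simp add: state_bits_def)
  moreover have "?l \<le> ?l ^ 4" using l power_increasing[of 1 4 ?l] by simp
  then have "real n * ?l \<le> real n * ?l ^ 4" "1 * ?l \<le> real n * ?l ^ 4"
    using n l by (intro mult_mono; simp)+
  moreover have "0 \<le> real n * ?l ^ 4" using l by simp
  ultimately show ?thesis by linarith
qed

section \<open>Tail estimates\<close>

lemma half_power_list_len_le:
  assumes "2 \<le> n"
  shows "(1 / 2) ^ list_len n \<le> 1 / real n ^ 4"
proof -
  have "real n ^ 4 = 2 powr (4 * log 2 (real n))"
    using assms powr_power[of 2 "log 2 (real n)" 4] by simp
  also have "\<dots> \<le> 2 powr real (list_len n)"
    using list_len_bounds(1)[OF assms] by (intro powr_mono) auto
  also have "\<dots> = 2 ^ list_len n" by (simp add: powr_realpow)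
  finally show ?thesis using assms by (simp add: power_one_over frac_le)
qed

text \<open>Let l be the logarithm. As \<open>list_len n\<close> is at most 5 l and
  \<open>harm n\<close> at most 2 l, the exponent is at most \<open>50 * l ^ 3\<close>; since
  \<open>2 * ln 2\<close> is at least 1, the exponential is at most
  \<open>2 powr (100 * l ^ 3)\<close>. The threshold 200 leaves a factor
  \<open>2 powr (- (100 * l ^ 3))\<close>.\<close>

lemma stored_tail_le:
  assumes n: "2 \<le> n"
  shows "exp ((real (list_len n))\<^sup>2 * harm n) / 2 powr (200 * log 2 (real n) ^ 3) \<le> 1 / real n ^ 6"
proof -
  let ?l = "log 2 (real n)"
  note l = log2_ge_1[OF n]
  have ln2: "1 / 2 \<le> ln (2 :: real)" "ln (2 :: real) \<le> 1"
    using ln2_ge_two_thirds ln_le_minus_one[of "2 :: real"] by auto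
  have "ln (real n) = ?l * ln 2" using n by (simp add: log_def)
  also have "\<dots> \<le> ?l" using l ln2 by (simp add: mult_left_le)
  finally have H: "harm n \<le> 2 * ?l" using harm_le_ln[of n] n l by linarith
  have "(real (list_len n))\<^sup>2 \<le> (5 * ?l)\<^sup>2"
    using list_len_bounds(2)[OF n] by (intro power_mono) auto
  then have "(real (list_len n))\<^sup>2 * harm n \<le> (5 * ?l)\<^sup>2 * (2 * ?l)"
    using H l harm_nonneg by (intro mult_mono) auto
  also have "\<dots> = 50 * ?l ^ 3 * 1" by (simp add: power2_eq_square power3_eq_cube)
  also have "\<dots> \<le> 50 * ?l ^ 3 * (2 * ln 2)" using l ln2 by (intro mult_left_mono) auto
  finally have "exp ((real (list_len n))\<^sup>2 * harm n) \<le> exp (50 * ?l ^ 3 * (2 * ln 2))" by simp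
  also have "\<dots> = 2 powr (100 * ?l ^ 3)" by (simp add: powr_def mult_ac)
  finally have "exp ((real (list_len n))\<^sup>2 * harm n) / 2 powr (200 * ?l ^ 3) \<le>
      2 powr (100 * ?l ^ 3) / 2 powr (200 * ?l ^ 3)"
    by (rule divide_right_mono) simp
  also have "\<dots> = 2 powr (- (100 * ?l ^ 3))" by (simp flip: powr_diff)
  also have "\<dots> \<le> 2 powr (- (6 * ?l))"
  proof (rule powr_mono)
    have "?l \<le> ?l ^ 3" using l power_increasing[of 1 3 ?l] by simp
    then show "- (100 * ?l ^ 3) \<le> - (6 * ?l)" using l by linarith
  qed simp
  also have "\<dots> = 1 / (2 powr ?l) ^ 6"
    using powr_power[of 2 ?l 6] by (simp add: powr_minus_divide)
  also have "2 powr ?l = real n" using n by simp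
  finally show ?thesis .
qed


section \<open>Union bound over the bad events\<close>

lemma run_not_None:
  assumes adv: "legal_adversary n L adv"
    and no_abort: "\<And>t s es cs e. run L P adv t = Some (s, es, cs) \<Longrightarrow> adv cs = Some e \<Longrightarrow>
      process_edge L P e s = None \<Longrightarrow> upper s e \<in> {1..n} \<Longrightarrow> next_level s e \<in> {1..min n L} \<Longrightarrow> False"
  shows "run L P adv t \<noteq> None"
proof (induction t)
  case (Suc t)
  then obtain s es cs where r: "run L P adv t = Some (s, es, cs)" by auto
  show ?case
  proof (cases "adv cs")
    case (Some e)
    note I = run_inv[OF adv r]
    \<comment> \<open>Degrees stay at most \<open>n\<close>, so aborts occur only at levels up to
      \<open>min n L\<close>; this keeps the union bound free of \<open>L\<close>.\<close>
    have "process_edge L P e s \<noteq> None"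
      using no_abort[OF r Some] next_level_le[OF I(1) I(5)[OF Some]] by auto
    then show ?thesis using r Some by auto
  qed (use r in simp)
qed simp

theorem theorem5p5:
  shows "\<exists>(C::real) (q::nat). \<forall>n\<ge>2. \<forall>L::nat.
    (L \<le> n \<longrightarrow>
      (\<forall>P \<in> set_pmf (lists_pmf n L).
         real (random_bits n L P) \<le> C * (real n * real L) * log 2 (real n) ^ q)) \<and>
    (\<forall>adv. legal_adversary n L adv \<longrightarrow>
      measure_pmf.prob (lists_pmf n L)
        {P. \<forall>t. \<exists>s es cs. run L P adv t = Some (s, es, cs) \<and>
           proper_coloring (edges_of es) (clr s) \<and>
           real (card (clr s ` {1..n})) \<le> C * real (max 1 (max_degree n (edges_of es))) ^ 3 \<and>
           real (state_bits n s) \<le> C * (real n * log 2 (real n) ^ 4)}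
      \<ge> 1 - C / (real n)\<^sup>2)"
\<comment> \<open>2100 is dictated by the space bound; the random bits take 20, the colors 3 and the
  failure probability 3.\<close>
proof (intro exI[of _ "2100::real"] exI[of _ "2::nat"] allI impI conjI ballI)
  fix n L :: nat and P :: color_lists
  assume "2 \<le> n" "L \<le> n" "P \<in> set_pmf (lists_pmf n L)"
  then have "real (random_bits n L P) \<le> 20 * (real n * real L) * log 2 (real n) ^ 2"
    by (rule random_bits_le)
  also have "\<dots> \<le> 2100 * (real n * real L) * log 2 (real n) ^ 2"
    by (intro mult_right_mono) auto
  finally show "real (random_bits n L P) \<le> 2100 * (real n * real L) * log 2 (real n) ^ 2" .
next
  fix n L :: nat and adv :: adversary
  assume n: "2 \<le> n" and adv: "legal_adversary n L adv"
  let ?M = "lists_pmf n L"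
  let ?G = "{P. \<forall>t. \<exists>s es cs. run L P adv t = Some (s, es, cs) \<and>
           proper_coloring (edges_of es) (clr s) \<and>
           real (card (clr s ` {1..n})) \<le> 2100 * real (max 1 (max_degree n (edges_of es))) ^ 3 \<and>
           real (state_bits n s) \<le> 2100 * (real n * log 2 (real n) ^ 4)}"
  \<comment> \<open>Bad events: \<open>X\<close> collects the aborts by vertex and level,
    \<open>F\<close> the vertices with too many stored edges at a given time.\<close>
  define X where "X = (\<lambda>(u, k). {P. \<exists>t s es cs e. run L P adv t = Some (s, es, cs) \<and>
      adv cs = Some e \<and> process_edge L P e s = None \<and> upper s e = u \<and> next_level s e = k})"
  define F where "F = (\<lambda>(u, t). {P. \<exists>s es cs. run L P adv t = Some (s, es, cs) \<and>
      200 * log 2 (real n) ^ 3 \<le> real (degree_in (stored s) u)})"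
  let ?I = "{1..n} \<times> {1..min n L}" and ?J = "{1..n} \<times> {..Suc (n\<^sup>2)}"
  have good: "P \<in> ?G" if P: "P \<in> set_pmf ?M" and X: "P \<notin> \<Union> (X ` ?I)" and F: "P \<notin> \<Union> (F ` ?J)" for P
  proof (intro CollectI allI)
    fix t
    have run: "run L P adv t \<noteq> None" for t
    proof (rule run_not_None[OF adv])
      fix t s es cs e
      assume "run L P adv t = Some (s, es, cs)" "adv cs = Some e" "process_edge L P e s = None"
      then have "P \<in> X (upper s e, next_level s e)" unfolding X_def by blast
      moreover assume "upper s e \<in> {1..n}" "next_level s e \<in> {1..min n L}"
      ultimately show False using X by blast
    qed
    \<comment> \<open>From round \<open>Suc (n\<^sup>2)\<close> on the game stands still, so the
      times in \<open>?J\<close> suffice.\<close>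
    define t' where "t' = min t (Suc (n\<^sup>2))"
    have "run L P adv t = run L P adv t'"
      using run_eq_at_square[OF adv run, of t] by (simp add: t'_def min_def)
    then obtain s es cs where r: "run L P adv t = Some (s, es, cs)"
      and r': "run L P adv t' = Some (s, es, cs)" using run[of t] by auto
    have "real (degree_in (stored s) u) \<le> 200 * log 2 (real n) ^ 3" if u: "u \<in> {1..n}" for u
    proof -
      have "P \<notin> F (u, t')" using F u by (auto simp: t'_def)
      then show ?thesis using r' by (auto simp: F_def)
    qed
    then have "real (state_bits n s) \<le> 2100 * (real n * log 2 (real n) ^ 4)"
      by (rule state_bits_le[OF n adv P r])
    moreover have "real (card (clr s ` {1..n})) \<le> 2100 * real (max 1 (max_degree n (edges_of es))) ^ 3"
      by (rule order_trans[OF card_colors_le[OF adv P r]]) (intro mult_right_mono, auto)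
    moreover have "proper_coloring (edges_of es) (clr s)"
      using run_inv(1)[OF adv r] by (simp add: alg_inv_def)
    ultimately show "\<exists>s es cs. run L P adv t = Some (s, es, cs) \<and>
       proper_coloring (edges_of es) (clr s) \<and>
       real (card (clr s ` {1..n})) \<le> 2100 * real (max 1 (max_degree n (edges_of es))) ^ 3 \<and>
       real (state_bits n s) \<le> 2100 * (real n * log 2 (real n) ^ 4)"
      using r by blast
  qed
  have X_le: "measure_pmf.prob ?M (X i) \<le> 1 / real n ^ 4" if "i \<in> ?I" for i
  proof -
    have "emeasure (measure_pmf ?M) (X i) \<le> ennreal ((1 / 2) ^ list_len n)"
      using abort_emeasure_le[OF adv] that by (auto simp: X_def)
    then have "measure_pmf.prob ?M (X i) \<le> (1 / 2) ^ list_len n"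
      by (simp add: measure_pmf.emeasure_eq_measure)
    also have "\<dots> \<le> 1 / real n ^ 4" by (rule half_power_list_len_le[OF n])
    finally show ?thesis .
  qed
  have F_le: "measure_pmf.prob ?M (F j) \<le> 1 / real n ^ 6" if "j \<in> ?J" for j
    using that order_trans[OF prob_many_stored_le[OF adv] stored_tail_le[OF n]]
    by (auto simp: F_def)
  have "measure_pmf.prob ?M (\<Union> (X ` ?I)) \<le> (\<Sum>i\<in>?I. measure_pmf.prob ?M (X i))"
    by (rule measure_UNION_le) auto
  also have "\<dots> \<le> (\<Sum>i\<in>?I. 1 / real n ^ 4)" by (intro sum_mono X_le)
  also have "\<dots> = real n * real (min n L) * (1 / real n ^ 4)" by simp
  also have "\<dots> \<le> real n * real n * (1 / real n ^ 4)"
    by (intro mult_right_mono mult_left_mono) auto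
  also have "\<dots> = 1 / (real n)\<^sup>2" using n by (simp add: power2_eq_square power4_eq_xxxx)
  finally have PX: "measure_pmf.prob ?M (\<Union> (X ` ?I)) \<le> 1 / (real n)\<^sup>2" .
  have n2: "2 \<le> (real n)\<^sup>2" using power_mono[of 2 "real n" 2] n by simp
  have "measure_pmf.prob ?M (\<Union> (F ` ?J)) \<le> (\<Sum>j\<in>?J. measure_pmf.prob ?M (F j))"
    by (rule measure_UNION_le) auto
  also have "\<dots> \<le> (\<Sum>j\<in>?J. 1 / real n ^ 6)" by (intro sum_mono F_le)
  \<comment> \<open>The times start at 0, so there are \<open>n\<^sup>2 + 2\<close> of them.\<close>
  also have "\<dots> = real n * ((real n)\<^sup>2 + 2) * (1 / real n ^ 6)"
    by (simp add: algebra_simps)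
  also have "\<dots> \<le> (real n)\<^sup>2 * ((real n)\<^sup>2 + (real n)\<^sup>2) * (1 / real n ^ 6)"
    using n n2 by (intro mult_right_mono mult_mono) (auto simp: power2_eq_square)
  also have "\<dots> = 2 / (real n)\<^sup>2" using n by (simp add: field_simps eval_nat_numeral)
  finally have PF: "measure_pmf.prob ?M (\<Union> (F ` ?J)) \<le> 2 / (real n)\<^sup>2" .
  \<comment> \<open>The bounds on colors and space were shown for lists in the support, so the bad
    set is first cut down to it.\<close>
  have "measure_pmf.prob ?M (- ?G) = measure_pmf.prob ?M (- ?G \<inter> set_pmf ?M)"
    by (rule measure_Int_set_pmf[symmetric])
  also have "\<dots> \<le> measure_pmf.prob ?M (\<Union> (X ` ?I) \<union> \<Union> (F ` ?J))"
    by (rule measure_pmf.finite_measure_mono) (use good in blast, simp)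
  also have "\<dots> \<le> measure_pmf.prob ?M (\<Union> (X ` ?I)) + measure_pmf.prob ?M (\<Union> (F ` ?J))"
    by (rule measure_Un_le) auto
  also have "\<dots> \<le> 3 / (real n)\<^sup>2" using PX PF by simp
  also have "\<dots> \<le> 2100 / (real n)\<^sup>2" by (intro divide_right_mono) auto
  finally show "1 - 2100 / (real n)\<^sup>2 \<le> measure_pmf.prob ?M ?G"
    using measure_pmf.prob_compl[of ?G ?M] by (simp add: Compl_eq_Diff_UNIV)
qed

end
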